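(* Let $G$ be a bipartite graph. Then $$\left\lceil \tfrac12 \mathrm{mad}(G)\right\rceil \le \vec{\chi}(G) \le \left\lceil \tfrac12 \mathrm{mad}(G)\right\rceil + 3.$$ This upper bound is tight: for each positive integer $k$ there exists a bipartite graph $G$ with $\left\lceil \tfrac12 \mathrm{mad}(G)\right\rceil = k$ and $\vec{\chi}(G) = k+3$.
   Context: All graphs are finite, simple and have at least one vertex. An orientation of $G$ chooses a direction for each edge; $d^+(v)$ is the number of edges directed out of $v$. An orientation is proper if $d^+(u)\neq d^+(v)$ for every edge $uv$. The proper orientation number $\vec{\chi}(G)$ is the minimum, over all proper orientations of $G$, of $\max_{v\in V(G)} d^+(v)$ (every graph has a proper orientation). The maximum average degree is $\mathrm{mad}(G)=\max_{H\subseteq G} \frac{2|E(H)|}{|V(H)|}$, the maximum over all subgraphs $H$ of $G$ with at least one vertex. *)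

theory Defs
  imports Complex_Main
begin

text \<open>A graph is given by its vertex set \<open>V\<close> and its set \<open>E\<close> of two-element edges.\<close>

definition simple_graph :: "'a set \<Rightarrow> 'a set set \<Rightarrow> bool" where
  "simple_graph V E \<longleftrightarrow> finite V \<and> V \<noteq> {} \<and> (\<forall>e\<in>E. e \<subseteq> V \<and> card e = 2)"

definition bipartite_graph :: "'a set \<Rightarrow> 'a set set \<Rightarrow> bool" where
  "bipartite_graph V E \<longleftrightarrow> simple_graph V E \<and>
     (\<exists>A B. A \<union> B = V \<and> A \<inter> B = {} \<and> (\<forall>e\<in>E. \<exists>a\<in>A. \<exists>b\<in>B. e = {a, b}))"

definition subgraph_of :: "'a set \<Rightarrow> 'a set set \<Rightarrow> 'a set \<Rightarrow> 'a set set \<Rightarrow> bool" where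
  "subgraph_of V' E' V E \<longleftrightarrow> simple_graph V' E' \<and> V' \<subseteq> V \<and> E' \<subseteq> E"

definition mad :: "'a set \<Rightarrow> 'a set set \<Rightarrow> real" where
  "mad V E = Max {2 * real (card E') / real (card V') | V' E'. subgraph_of V' E' V E}"

text \<open>An orientation is a set \<open>D\<close> of arcs; \<open>(u, v) \<in> D\<close> means that the edge \<open>{u, v}\<close> is
  directed from \<open>u\<close> to \<open>v\<close>.\<close>

definition orientation :: "'a set set \<Rightarrow> ('a \<times> 'a) set \<Rightarrow> bool" where
  "orientation E D \<longleftrightarrow>
     (\<forall>u v. (u, v) \<in> D \<longrightarrow> {u, v} \<in> E) \<and>
     (\<forall>u v. {u, v} \<in> E \<longrightarrow> ((u, v) \<in> D \<longleftrightarrow> (v, u) \<notin> D))"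

definition out_deg :: "('a \<times> 'a) set \<Rightarrow> 'a \<Rightarrow> nat" where
  "out_deg D v = card {w. (v, w) \<in> D}"

definition proper_orientation :: "'a set set \<Rightarrow> ('a \<times> 'a) set \<Rightarrow> bool" where
  "proper_orientation E D \<longleftrightarrow> orientation E D \<and>
     (\<forall>u v. {u, v} \<in> E \<longrightarrow> out_deg D u \<noteq> out_deg D v)"

text \<open>The minimum below is attained because every graph has a proper orientation: repeatedly
  pick a vertex of maximum degree, direct its remaining edges outwards, and delete it.\<close>

definition proper_orientation_number :: "'a set \<Rightarrow> 'a set set \<Rightarrow> nat" where
  "proper_orientation_number V E =
     (LEAST k. \<exists>D. proper_orientation E D \<and> Max (out_deg D ` V) = k)"

end

theory Submission
  imports Defs "HOL-Library.Countable"
begin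

text \<open>
  Write \<open>k\<close> for \<open>\<lceil>mad V E / 2\<rceil>\<close>. An orientation with all out-degrees at most \<open>m\<close> gives every subgraph
  at most \<open>m\<close> edges per vertex, and the lower bound follows.

  \<^bold>\<open>Upper bound.\<close> Every set \<open>X\<close> of vertices spans at most \<open>k * card X\<close> edges. Two tools move
  out-degrees around. Reversing a directed path takes one unit from its start and gives it to its
  end (\<open>shift_along_path\<close>); sparsity guarantees that a vertex of out-degree above \<open>k\<close> reaches one of
  out-degree below \<open>k\<close> (\<open>ex_reachable_small_out_deg\<close>). And if all arcs outside a set \<open>F\<close> of edges
  are frozen, an orientation that maximises the sum of the squared out-degrees has no conflict on
  \<open>F\<close> (\<open>ex_orientation_proper_on\<close>): reversing an arc between two vertices of out-degree \<open>d\<close> would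
  produce \<open>d - 1\<close> and \<open>d + 1\<close>. It therefore suffices to find a partial orientation whose frozen arcs
  already separate the out-degrees across all other edges.

  Let \<open>A\<close> and \<open>B\<close> be the colour classes. The vertices of \<open>B\<close> of degree at least \<open>k + 3\<close> (the large
  ones) are given out-degree exactly \<open>k + 3\<close>, those of \<open>A\<close> at most \<open>k + 2\<close>, and then as much
  out-degree as possible is moved into \<open>A\<close>. Let \<open>T\<close> be the set of vertices of \<open>A\<close> that reach
  \<open>k + 2\<close>. By maximality no path leads from a small vertex of \<open>B\<close> to \<open>A - T\<close>
  (\<open>saturated_no_path\<close>), so every edge between the two is directed out of \<open>A - T\<close>. Large vertices
  and \<open>T\<close> are now settled. A small vertex of \<open>B\<close> can conflict with \<open>T\<close> only if it has degree \<open>k + 2\<close>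
  and is a source, and at level \<open>k + 1\<close> it can conflict with \<open>A - T\<close> only if it has degree \<open>k + 2\<close>
  and a single in-arc. So the vertices \<open>s\<close> of \<open>B\<close> of degree \<open>k + 2\<close> without an in-arc from \<open>T\<close> are
  the only ones that need care; let \<open>U\<close> be the set of these and \<open>N s\<close> the set of neighbours of \<open>s\<close>
  in \<open>A - T\<close>.

  The density condition makes it possible to choose the orientation such that \<open>N s\<close> has at least two
  elements for each \<open>s\<close> in \<open>U\<close> (\<open>ex_saturated_hitting\<close>). Call a vertex of \<open>A - T\<close> safe if its
  out-degree, which can only decrease from now on, is at most \<open>k\<close>. If \<open>N s\<close> contains a safe vertex
  \<open>p s\<close>, let that vertex keep its arc to \<open>s\<close> and reverse all other arcs into \<open>s\<close>: then \<open>s\<close> has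
  out-degree \<open>k + 1\<close>, and every other vertex of \<open>N s\<close> loses an arc and becomes safe as well. Safety
  spreads in this way (\<open>ex_escape_parents\<close>). In the end each \<open>s\<close> in \<open>U\<close> has either only safe
  neighbours in \<open>A - T\<close>, and out-degree \<open>k + 1\<close>, or only unsafe ones, of out-degree exactly
  \<open>k + 1\<close>, which all direct their edges to \<open>s\<close> and leave it with out-degree at most \<open>k\<close>. The edges
  between safe vertices and the remaining small vertices of \<open>B\<close> are left to the sum of squares.

  \<^bold>\<open>Tightness.\<close> Let \<open>k\<close> be positive and suppose that all out-
  degrees are at most \<open>k + 2\<close>. A hub is forced to avoid an out-degree
  \<open>j\<close> by a neighbour of out-degree \<open>j\<close>; so many disjoint gadgets are
  attached to each small group of hubs that the hubs direct no edge into at least one of them.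
  Such gadgets exclude the values \<open>1, \<dots>, k + 1\<close>. The hubs of both colours that
  carry gadgets form a tree with two adjacent centres of degree \<open>k + 3\<close>. One of the
  centres has an outgoing arc and hence out-degree \<open>k + 2\<close>. This is less than its
  degree in the tree, so it has an incoming arc from another hub, which then has out-degree
  \<open>k + 2\<close> as well.
\<close>

section \<open>Orientations of finite graphs\<close>

definition reverse_arcs :: "('a \<times> 'a) set \<Rightarrow> ('a \<times> 'a) set \<Rightarrow> ('a \<times> 'a) set" where
  "reverse_arcs D X = (D - X) \<union> X\<inverse>"

locale finite_simple_graph =
  fixes V :: "'a set" and E :: "'a set set"
  assumes simple: "simple_graph V E"
begin

definition nbrs :: "'a \<Rightarrow> 'a set" where
  "nbrs v = {w. {v, w} \<in> E}"

lemma finite_V: "finite V"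
  using simple by (simp add: simple_graph_def)

lemma edge_neq: "{u, v} \<in> E \<Longrightarrow> u \<noteq> v"
  using simple by (force simp: simple_graph_def)

lemma edge_in_V: "{u, v} \<in> E \<Longrightarrow> u \<in> V \<and> v \<in> V"
  using simple by (auto simp: simple_graph_def)

lemma edge_cases:
  assumes "e \<in> E"
  obtains u v where "e = {u, v}" "u \<noteq> v"
  using assms simple that unfolding simple_graph_def card_2_iff by metis

lemma finite_E: "finite E"
  using finite_V simple by (intro finite_subset[of E "Pow V"]) (auto simp: simple_graph_def)

lemma nbrs_subset: "nbrs v \<subseteq> V"
  using edge_in_V by (auto simp: nbrs_def)

lemma finite_nbrs: "finite (nbrs v)"
  using nbrs_subset finite_V by (rule finite_subset)

lemma arc_edge: "orientation E D \<Longrightarrow> (u, v) \<in> D \<Longrightarrow> {u, v} \<in> E"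
  by (simp add: orientation_def)

lemma arc_asym: "orientation E D \<Longrightarrow> (u, v) \<in> D \<Longrightarrow> (v, u) \<notin> D"
  by (metis orientation_def)

lemma arc_total: "orientation E D \<Longrightarrow> {u, v} \<in> E \<Longrightarrow> (u, v) \<notin> D \<Longrightarrow> (v, u) \<in> D"
  by (metis orientation_def)

lemma out_subset_nbrs: "orientation E D \<Longrightarrow> {w. (v, w) \<in> D} \<subseteq> nbrs v"
  using arc_edge by (auto simp: nbrs_def)

lemma finite_out: "orientation E D \<Longrightarrow> finite {w. (v, w) \<in> D}"
  using out_subset_nbrs finite_nbrs by (metis finite_subset)

lemma out_deg_le_in:
  assumes "orientation E D" and "\<And>u. u \<in> I \<Longrightarrow> (u, v) \<in> D"
  shows "out_deg D v + card I \<le> card (nbrs v)"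
proof -
  have I: "I \<subseteq> nbrs v"
    using assms arc_edge by (auto simp: nbrs_def insert_commute)
  have "{w. (v, w) \<in> D} \<inter> I = {}"
    using assms arc_asym by blast
  then have "out_deg D v + card I = card ({w. (v, w) \<in> D} \<union> I)"
    unfolding out_deg_def
    using finite_out[OF assms(1)] I finite_nbrs by (metis card_Un_disjoint finite_subset)
  also have "\<dots> \<le> card (nbrs v)"
    using I out_subset_nbrs[OF assms(1)] finite_nbrs by (intro card_mono) auto
  finally show ?thesis .
qed

lemma orientation_subset: "orientation E D \<Longrightarrow> D \<subseteq> V \<times> V"
proof
  fix a assume "orientation E D" and "a \<in> D"
  then show "a \<in> V \<times> V"
    using arc_edge[of D "fst a" "snd a"] edge_in_V by (cases a) auto
qed

lemma in_V_of_out_deg: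
  assumes "orientation E D" and "0 < out_deg D v"
  shows "v \<in> V"
proof -
  have "{w. (v, w) \<in> D} \<noteq> {}"
    using assms(2) unfolding out_deg_def by (metis card.empty less_irrefl)
  then show ?thesis
    using orientation_subset[OF assms(1)] by auto
qed

lemma finite_orientations: "finite {D. orientation E D}"
proof (rule finite_subset)
  show "{D. orientation E D} \<subseteq> Pow (V \<times> V)"
    using orientation_subset by blast
qed (use finite_V in simp)

lemma ex_orientation: "\<exists>D. orientation E D"
proof
  let ?D = "{(u, v). {u, v} \<in> E \<and> u = (SOME x. x \<in> {u, v})}"
  have some: "(SOME x. x \<in> {u, v}) = u \<or> (SOME x. x \<in> {u, v}) = v" for u v :: 'a
    using someI[of "\<lambda>x. x \<in> {u, v}" u] by simp
  show "orientation E ?D"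
    unfolding orientation_def
  proof (intro conjI allI impI)
    fix u v assume "{u, v} \<in> E"
    moreover have "{v, u} = {u, v}" by blast
    ultimately show "(u, v) \<in> ?D \<longleftrightarrow> (v, u) \<notin> ?D"
      using some[of u v] edge_neq[of u v] by (simp only: mem_Collect_eq case_prod_conv) metis
  qed simp
qed

text \<open>There are only finitely many orientations, which justifies the maximal choices below.\<close>

lemma ex_max_orientation:
  fixes f :: "('a \<times> 'a) set \<Rightarrow> nat"
  assumes "orientation E D0" and "P D0"
  obtains D where "orientation E D" and "P D"
    and "\<And>D'. orientation E D' \<Longrightarrow> P D' \<Longrightarrow> f D' \<le> f D"
proof -
  let ?S = "{D. orientation E D \<and> P D}"
  have fin: "finite (f ` ?S)"
    using finite_orientations by (auto intro: finite_subset[of ?S])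
  have "Max (f ` ?S) \<in> f ` ?S"
    using fin assms by (intro Max_in) auto
  then obtain D where "D \<in> ?S" "f D = Max (f ` ?S)"
    by auto
  then show thesis
    using that[of D] fin by auto
qed

lemma orientation_reverse_arcs:
  assumes D: "orientation E D" and X: "X \<subseteq> D"
  shows "orientation E (reverse_arcs D X)"
  unfolding orientation_def
proof (intro conjI allI impI)
  fix u v assume "(u, v) \<in> reverse_arcs D X"
  then show "{u, v} \<in> E"
    using arc_edge[OF D, of u v] arc_edge[OF D, of v u] X
    by (auto simp: reverse_arcs_def insert_commute)
next
  fix u v assume "{u, v} \<in> E"
  then show "(u, v) \<in> reverse_arcs D X \<longleftrightarrow> (v, u) \<notin> reverse_arcs D X"
    using arc_asym[OF D] arc_total[OF D, of u v] X unfolding reverse_arcs_def by blast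
qed

lemma flip_arc:
  assumes D: "orientation E D" and arc: "(u, v) \<in> D"
  defines "D' \<equiv> reverse_arcs D {(u, v)}"
  shows "orientation E D'" and "out_deg D' u + 1 = out_deg D u"
    and "out_deg D' v = out_deg D v + 1"
    and "\<And>w. w \<noteq> u \<Longrightarrow> w \<noteq> v \<Longrightarrow> out_deg D' w = out_deg D w"
proof -
  have neq: "u \<noteq> v"
    using arc_edge[OF D arc] edge_neq by blast
  show "orientation E D'"
    unfolding D'_def using D arc by (intro orientation_reverse_arcs) auto
  have "{w. (u, w) \<in> D'} = {w. (u, w) \<in> D} - {v}"
    using neq by (auto simp: D'_def reverse_arcs_def)
  then show "out_deg D' u + 1 = out_deg D u"
    unfolding out_deg_def using arc finite_out[OF D, of u]
    by (metis Suc_eq_plus1 card_Suc_Diff1 mem_Collect_eq)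
  have "{w. (v, w) \<in> D'} = insert u {w. (v, w) \<in> D}"
    using neq by (auto simp: D'_def reverse_arcs_def)
  then show "out_deg D' v = out_deg D v + 1"
    unfolding out_deg_def using arc_asym[OF D arc] finite_out[OF D, of v] by simp
  show "out_deg D' w = out_deg D w" if "w \<noteq> u" "w \<noteq> v" for w
  proof -
    have "{x. (w, x) \<in> D'} = {x. (w, x) \<in> D}"
      using that by (auto simp: D'_def reverse_arcs_def)
    then show ?thesis
      by (simp add: out_deg_def)
  qed
qed

text \<open>
  The path is reversed from its far end. The last conjunct, that arcs with an end off the path stay
  put, ensures that the first arc of the path is still there when its turn comes.
\<close>

lemma shift_along_simple_path:
  assumes "orientation E D" and "successively (\<lambda>u v. (u, v) \<in> D) (x # p)"
    and "distinct (x # p)" and "p \<noteq> []"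
  shows "\<exists>D'. orientation E D' \<and> out_deg D' x + 1 = out_deg D x
    \<and> out_deg D' (last p) = out_deg D (last p) + 1
    \<and> (\<forall>v. v \<noteq> x \<longrightarrow> v \<noteq> last p \<longrightarrow> out_deg D' v = out_deg D v)
    \<and> (\<forall>u v. u \<notin> set (x # p) \<longrightarrow> ((u, v) \<in> D' \<longleftrightarrow> (u, v) \<in> D) \<and> ((v, u) \<in> D' \<longleftrightarrow> (v, u) \<in> D))"
  using assms
proof (induction p arbitrary: x)
  case Nil
  then show ?case by simp
next
  case (Cons y q)
  have xy: "(x, y) \<in> D"
    using Cons.prems by simp
  show ?case
  proof (cases "q = []")
    case True
    show ?thesis
      using flip_arc[OF Cons.prems(1) xy] True
      by (intro exI[of _ "reverse_arcs D {(x, y)}"]) (auto simp: reverse_arcs_def)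
  next
    case False
    obtain D1 where D1: "orientation E D1" "out_deg D1 y + 1 = out_deg D y"
      "out_deg D1 (last q) = out_deg D (last q) + 1"
      "\<And>v. v \<noteq> y \<Longrightarrow> v \<noteq> last q \<Longrightarrow> out_deg D1 v = out_deg D v"
      "\<And>u v. u \<notin> set (y # q) \<Longrightarrow> ((u, v) \<in> D1 \<longleftrightarrow> (u, v) \<in> D) \<and> ((v, u) \<in> D1 \<longleftrightarrow> (v, u) \<in> D)"
      using Cons.IH[of y] Cons.prems False by auto
    have x: "x \<notin> set (y # q)" "last q \<in> set q" "y \<notin> set q"
      using Cons.prems False by auto
    then have xy1: "(x, y) \<in> D1"
      using D1(5) xy by blast
    define D2 where "D2 = reverse_arcs D1 {(x, y)}"
    note D2 = flip_arc[OF D1(1) xy1, folded D2_def]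
    have "x \<noteq> last q" "y \<noteq> last q" "x \<noteq> y"
      using x by auto
    then have "out_deg D2 x + 1 = out_deg D x" "out_deg D2 (last q) = out_deg D (last q) + 1"
      "\<forall>v. v \<noteq> x \<longrightarrow> v \<noteq> last q \<longrightarrow> out_deg D2 v = out_deg D v"
      using D2 D1 by (metis, metis, metis)
    moreover have "\<forall>u v. u \<notin> set (x # y # q) \<longrightarrow>
      ((u, v) \<in> D2 \<longleftrightarrow> (u, v) \<in> D) \<and> ((v, u) \<in> D2 \<longleftrightarrow> (v, u) \<in> D)"
      using D1(5) by (auto simp: D2_def reverse_arcs_def)
    ultimately show ?thesis
      using D2(1) False by auto
  qed
qed

lemma simple_path_of_reachable:
  assumes "(x, z) \<in> D\<^sup>*"
  shows "\<exists>p. successively (\<lambda>u v. (u, v) \<in> D) (x # p) \<and> distinct (x # p) \<and> last (x # p) = z"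
  using assms
proof (induction rule: converse_rtrancl_induct)
  case base
  show ?case by (intro exI[of _ "[]"]) simp
next
  case (step x y)
  then obtain p where p: "successively (\<lambda>u v. (u, v) \<in> D) (y # p)" "distinct (y # p)"
    "last (y # p) = z"
    by blast
  show ?case
  proof (cases "x \<in> set (y # p)")
    case False
    then show ?thesis
      using p step by (intro exI[of _ "y # p"]) auto
  next
    case True
    then obtain q r where qr: "y # p = q @ x # r"
      by (meson split_list)
    have "successively (\<lambda>u v. (u, v) \<in> D) (x # r)" "distinct (x # r)" "last (x # r) = z"
      using p unfolding qr by (auto simp: successively_append_iff)
    then show ?thesis by blast
  qed
qed

lemma shift_along_path:
  assumes "orientation E D" and "(x, z) \<in> D\<^sup>*" and "x \<noteq> z"
  obtains D' where "orientation E D'" and "out_deg D' x + 1 = out_deg D x"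
    and "out_deg D' z = out_deg D z + 1"
    and "\<And>v. v \<noteq> x \<Longrightarrow> v \<noteq> z \<Longrightarrow> out_deg D' v = out_deg D v"
proof -
  obtain p where p: "successively (\<lambda>u v. (u, v) \<in> D) (x # p)" "distinct (x # p)"
    "last (x # p) = z"
    using simple_path_of_reachable[OF assms(2)] by blast
  then have "p \<noteq> []" "last p = z"
    using assms(3) by auto
  then show thesis
    using shift_along_simple_path[OF assms(1) p(1,2)] that by metis
qed

text \<open>The arcs that leave the vertices of a closed set are distinct edges inside the set.\<close>

lemma sum_out_deg_le_edges:
  assumes D: "orientation E D" and closed: "\<And>u v. u \<in> R \<Longrightarrow> (u, v) \<in> D \<Longrightarrow> v \<in> R"
    and R: "R \<subseteq> V"
  shows "(\<Sum>v\<in>R. out_deg D v) \<le> card {e \<in> E. e \<subseteq> R}"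
proof -
  let ?S = "SIGMA v:R. {w. (v, w) \<in> D}"
  have "finite R"
    using R finite_V by (rule finite_subset)
  then have "(\<Sum>v\<in>R. out_deg D v) = card ?S"
    unfolding out_deg_def using finite_out[OF D] by (subst card_SigmaI) auto
  also have "\<dots> \<le> card {e \<in> E. e \<subseteq> R}"
  proof (rule card_inj_on_le)
    show "inj_on (\<lambda>(u, v). {u, v}) ?S"
      using arc_asym[OF D] by (auto simp: inj_on_def doubleton_eq_iff)
    show "(\<lambda>(u, v). {u, v}) ` ?S \<subseteq> {e \<in> E. e \<subseteq> R}"
      using closed arc_edge[OF D] by auto
    show "finite {e \<in> E. e \<subseteq> R}"
      using finite_E by simp
  qed
  finally show ?thesis .
qed

text \<open>
  Maximise the sum of the squared out-degrees over all orientations that agree with \<open>D0\<close> outside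
  \<open>F\<close>. Reversing an arc of \<open>F\<close> between two vertices of out-degree \<open>d\<close> would change
  \<open>d\<^sup>2 + d\<^sup>2\<close> into \<open>(d - 1)\<^sup>2 + (d + 1)\<^sup>2\<close>, which is larger by two. For \<open>F = E\<close> this shows that
  proper orientations exist.
\<close>

lemma ex_orientation_proper_on:
  assumes D0: "orientation E D0" and F: "F \<subseteq> E"
  obtains D where "orientation E D"
    and "\<And>u v. {u, v} \<notin> F \<Longrightarrow> (u, v) \<in> D \<longleftrightarrow> (u, v) \<in> D0"
    and "\<And>u v. {u, v} \<in> F \<Longrightarrow> out_deg D u \<noteq> out_deg D v"
proof -
  let ?P = "\<lambda>D. \<forall>u v. {u, v} \<notin> F \<longrightarrow> ((u, v) \<in> D \<longleftrightarrow> (u, v) \<in> D0)"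
  let ?f = "\<lambda>D. \<Sum>v\<in>V. (out_deg D v)\<^sup>2"
  have "?P D0" by simp
  from ex_max_orientation[of D0 ?P ?f, OF D0 this] obtain D
    where D: "orientation E D" "?P D"
    and max: "\<And>D'. orientation E D' \<Longrightarrow> ?P D' \<Longrightarrow> ?f D' \<le> ?f D"
    by blast
  have no: False if arc: "(u, v) \<in> D" and uv: "{u, v} \<in> F" "out_deg D u = out_deg D v" for u v
  proof -
    define D' where "D' = reverse_arcs D {(u, v)}"
    note D' = flip_arc[OF D(1) arc, folded D'_def]
    have P: "?P D'"
      using D(2) uv(1) by (auto simp: D'_def reverse_arcs_def insert_commute)
    have V: "u \<in> V" "v \<in> V" "u \<noteq> v"
      using arc_edge[OF D(1) arc] edge_in_V edge_neq by auto
    have split: "sum g V = sum g (V - {u, v}) + (g u + g v)" for g :: "'a \<Rightarrow> nat"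
      using V finite_V sum.subset_diff[of "{u, v}" V g] by simp
    have "sum (\<lambda>w. (out_deg D' w)\<^sup>2) (V - {u, v}) = sum (\<lambda>w. (out_deg D w)\<^sup>2) (V - {u, v})"
      using D'(4) by (intro sum.cong) auto
    moreover have "(out_deg D u)\<^sup>2 + (out_deg D v)\<^sup>2 < (out_deg D' u)\<^sup>2 + (out_deg D' v)\<^sup>2"
    proof -
      have "out_deg D u = out_deg D' u + 1" "out_deg D v = out_deg D' u + 1"
        "out_deg D' v = out_deg D' u + 2"
        using D'(2,3) uv(2) by auto
      then show ?thesis by (simp add: power2_eq_square algebra_simps)
    qed
    ultimately have "?f D < ?f D'"
      unfolding split by linarith
    then show False
      using max[OF D'(1) P] by simp
  qed
  have "out_deg D u \<noteq> out_deg D v" if "{u, v} \<in> F" for u v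
    using no[of u v] no[of v u] arc_total[OF D(1), of u v] that F
    by (metis insert_commute subsetD)
  then show thesis
    using that D by blast
qed

text \<open>
  Otherwise the set of vertices reachable from \<open>u\<close>, which is closed under arcs, would have average
  out-degree above \<open>k\<close> and hence span too many edges.
\<close>

lemma ex_reachable_small_out_deg:
  assumes D: "orientation E D"
    and sparse: "\<And>X. X \<subseteq> V \<Longrightarrow> card {e \<in> E. e \<subseteq> X} \<le> k * card X"
    and u: "k < out_deg D u"
  obtains z where "(u, z) \<in> D\<^sup>*" and "out_deg D z < k"
proof -
  define R where "R = D\<^sup>* `` {u}"
  have uV: "u \<in> V"
    using in_V_of_out_deg[OF D, of u] u by simp
  have RV: "R \<subseteq> V"
    using uV orientation_subset[OF D] by (auto simp: R_def elim: rtranclE)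
  have fin: "finite R" using RV finite_V finite_subset by blast
  have uR: "u \<in> R" by (simp add: R_def)
  have "\<exists>z\<in>R. out_deg D z < k"
  proof (rule ccontr)
    assume "\<not> (\<exists>z\<in>R. out_deg D z < k)"
    then have ge: "\<forall>z\<in>R. k \<le> out_deg D z" by auto
    have "k * card R = (\<Sum>v\<in>R. k)" by simp
    also have "\<dots> < (\<Sum>v\<in>R. out_deg D v)"
      using ge u uR fin by (intro sum_strict_mono_ex1 bexI[of _ u]) auto
    also have "\<dots> \<le> card {e \<in> E. e \<subseteq> R}"
      by (rule sum_out_deg_le_edges[OF D _ RV]) (auto simp: R_def intro: rtrancl_into_rtrancl)
    finally show False using sparse[OF RV] by simp
  qed
  then show thesis using that by (auto simp: R_def)
qed

text \<open>
  An orientation that minimises the total excess over \<open>k\<close> has no excess: a vertex above \<open>k\<close> could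
  pass a unit along a path to a vertex below \<open>k\<close>.
\<close>

lemma ex_bounded_orientation:
  assumes sparse: "\<And>X. X \<subseteq> V \<Longrightarrow> card {e \<in> E. e \<subseteq> X} \<le> k * card X"
  obtains D where "orientation E D" and "\<And>v. out_deg D v \<le> k"
proof -
  let ?m = "\<lambda>D. \<Sum>v\<in>V. out_deg D v - k"
  obtain D where D: "orientation E D" and min: "\<And>D'. orientation E D' \<Longrightarrow> ?m D \<le> ?m D'"
    using ex_orientation ex_has_least_nat[of "orientation E" _ ?m] by blast
  have "out_deg D u \<le> k" for u
  proof (rule ccontr)
    assume u: "\<not> out_deg D u \<le> k"
    then obtain z where z: "(u, z) \<in> D\<^sup>*" "out_deg D z < k"
      using ex_reachable_small_out_deg[OF D sparse] by (metis not_le)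
    then have neq: "u \<noteq> z" using u by auto
    from shift_along_path[OF D z(1) neq] obtain D' where D': "orientation E D'"
      "out_deg D' u + 1 = out_deg D u" "out_deg D' z = out_deg D z + 1"
      "\<And>v. v \<noteq> u \<Longrightarrow> v \<noteq> z \<Longrightarrow> out_deg D' v = out_deg D v"
      by metis
    have uV: "u \<in> V"
      using in_V_of_out_deg[OF D, of u] u by simp
    have "out_deg D' v - k \<le> out_deg D v - k" for v
      using D' z(2) by (cases "v = u"; cases "v = z") auto
    then have "?m D' < ?m D"
      using D'(2) u uV finite_V by (intro sum_strict_mono_ex1 bexI[of _ u]) auto
    then show False using min[OF D'(1)] by simp
  qed
  then show thesis using that D by blast
qed

end

text \<open>
  The combinatorics of spreading safety. Each \<open>s\<close> in \<open>U\<close> is a hyperedge \<open>N s\<close>; as soon as one of its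
  elements is safe, it can be elected as the one element \<open>p s\<close> of \<open>N s\<close> that is not helped by \<open>s\<close>,
  and \<open>s\<close> makes all others safe. \<open>R\<close> is the set of vertices connected to \<open>R0\<close>, and \<open>p s\<close> is an
  element of \<open>N s\<close> nearest to \<open>R0\<close>, so a vertex of \<open>R - R0\<close> is helped by the last hyperedge on a
  shortest walk to it.
\<close>

lemma ex_escape_parents:
  fixes N :: "'b \<Rightarrow> 'a set"
  shows "\<exists>R p. R0 \<subseteq> R \<and> R \<subseteq> R0 \<union> (\<Union>s\<in>U. N s)
    \<and> (\<forall>s\<in>U. N s \<inter> R \<noteq> {} \<longrightarrow> N s \<subseteq> R \<and> p s \<in> N s)
    \<and> (\<forall>a\<in>R - R0. \<exists>s\<in>U. a \<in> N s \<and> p s \<noteq> a)"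
proof -
  define r where "r = {(a, a'). \<exists>s\<in>U. a \<in> N s \<and> a' \<in> N s}"
  define R where "R = r\<^sup>* `` R0"
  define d where "d a = (LEAST n. \<exists>a0\<in>R0. (a0, a) \<in> r ^^ n)" for a
  have d_le: "d a \<le> n" if "a0 \<in> R0" "(a0, a) \<in> r ^^ n" for a a0 n
    unfolding d_def using that by (intro Least_le) auto
  have d_witness: "\<exists>a0\<in>R0. (a0, a) \<in> r ^^ d a" if "a \<in> R" for a
  proof -
    have "\<exists>n. \<exists>a0\<in>R0. (a0, a) \<in> r ^^ n"
      using that unfolding R_def by (meson ImageE rtrancl_imp_relpow)
    then show ?thesis
      unfolding d_def by (rule LeastI_ex)
  qed
  have "\<exists>x. N s \<noteq> {} \<longrightarrow> x \<in> N s \<and> (\<forall>y\<in>N s. d x \<le> d y)" for s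
    using ex_has_least_nat[of "\<lambda>x. x \<in> N s" _ d] by blast
  then obtain p where p: "\<And>s. N s \<noteq> {} \<Longrightarrow> p s \<in> N s \<and> (\<forall>y\<in>N s. d (p s) \<le> d y)"
    by metis
  have "R \<subseteq> R0 \<union> (\<Union>s\<in>U. N s)"
  proof
    fix a assume "a \<in> R"
    then obtain a0 where "a0 \<in> R0" "(a0, a) \<in> r\<^sup>*" by (auto simp: R_def)
    from this(2,1) show "a \<in> R0 \<union> (\<Union>s\<in>U. N s)"
      by (cases rule: rtranclE) (auto simp: r_def)
  qed
  moreover have "N s \<subseteq> R" if "s \<in> U" "N s \<inter> R \<noteq> {}" for s
  proof
    fix a' assume "a' \<in> N s"
    moreover from that obtain a where a: "a \<in> N s" "a \<in> R" by blast
    ultimately have "(a, a') \<in> r" using that by (auto simp: r_def)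
    then show "a' \<in> R"
      using a unfolding R_def by (auto intro: rtrancl_into_rtrancl)
  qed
  moreover have "\<exists>s\<in>U. a \<in> N s \<and> p s \<noteq> a" if a: "a \<in> R - R0" for a
  proof -
    obtain a0 where a0: "a0 \<in> R0" "(a0, a) \<in> r ^^ d a"
      using d_witness a by blast
    then have "d a \<noteq> 0" using a by (metis DiffE relpow_0_E)
    then obtain n where n: "d a = Suc n" by (cases "d a") auto
    then obtain a' where a': "(a0, a') \<in> r ^^ n" "(a', a) \<in> r"
      using a0 by auto
    then obtain s where s: "s \<in> U" "a' \<in> N s" "a \<in> N s" by (auto simp: r_def)
    have "d (p s) \<le> d a'" using p s by blast
    also have "d a' \<le> n" using d_le a0 a' by blast
    finally have "p s \<noteq> a" using n by auto
    then show ?thesis using s by blast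
  qed
  moreover have "R0 \<subseteq> R" by (auto simp: R_def)
  ultimately show ?thesis
    using p by (intro exI[of _ R] exI[of _ p]) blast
qed

section \<open>Proper orientations of sparse bipartite graphs\<close>

locale sparse_bipartite_graph = finite_simple_graph +
  fixes A B :: "'a set" and k :: nat
  assumes parts: "A \<union> B = V" "A \<inter> B = {}"
    and bipartite: "e \<in> E \<Longrightarrow> \<exists>a\<in>A. \<exists>b\<in>B. e = {a, b}"
    and sparse: "X \<subseteq> V \<Longrightarrow> card {e \<in> E. e \<subseteq> X} \<le> k * card X"
begin

definition Large :: "'a set" where
  "Large = {b \<in> B. k + 3 \<le> card (nbrs b)}"

definition feasible :: "('a \<times> 'a) set \<Rightarrow> bool" where
  "feasible D \<longleftrightarrow> orientation E D \<and> (\<forall>a\<in>A. out_deg D a \<le> k + 2) \<and> (\<forall>b\<in>Large. out_deg D b = k + 3)"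

definition saturated :: "('a \<times> 'a) set \<Rightarrow> bool" where
  "saturated D \<longleftrightarrow> feasible D \<and>
     (\<forall>D'. feasible D' \<longrightarrow> (\<Sum>a\<in>A. out_deg D' a) \<le> (\<Sum>a\<in>A. out_deg D a))"

lemma saturated_feasible: "saturated D \<Longrightarrow> feasible D"
  by (simp add: saturated_def)

lemma feasibleD:
  assumes "feasible D"
  shows "orientation E D" and "a \<in> A \<Longrightarrow> out_deg D a \<le> k + 2"
    and "b \<in> Large \<Longrightarrow> out_deg D b = k + 3"
  using assms by (simp_all add: feasible_def)

lemma Large_subset: "Large \<subseteq> B"
  by (auto simp: Large_def)

lemma finite_parts: "finite A" "finite B"
  using parts finite_V by (metis finite_Un)+

lemma nbrs_A: "a \<in> A \<Longrightarrow> w \<in> nbrs a \<Longrightarrow> w \<in> B"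
  using bipartite[of "{a, w}"] parts(2) by (auto simp: nbrs_def doubleton_eq_iff)

lemma nbrs_B: "b \<in> B \<Longrightarrow> w \<in> nbrs b \<Longrightarrow> w \<in> A"
  using bipartite[of "{b, w}"] parts(2) by (auto simp: nbrs_def doubleton_eq_iff)

text \<open>
  In an orientation with out-degrees at most \<open>k\<close>, a large vertex of \<open>B\<close> can be raised to \<open>k + 3\<close> by
  reversing arcs into it; this only lowers vertices of \<open>A\<close>.
\<close>

lemma ex_feasible: "\<exists>D. feasible D"
proof -
  let ?P = "\<lambda>D. (\<forall>a\<in>A. out_deg D a \<le> k + 2) \<and> (\<forall>b\<in>B. out_deg D b \<le> k + 3)"
  let ?f = "\<lambda>D. \<Sum>b\<in>Large. out_deg D b"
  obtain D0 where D0: "orientation E D0" "\<And>v. out_deg D0 v \<le> k"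
    using ex_bounded_orientation[of k] sparse by blast
  have "?P D0"
    using D0(2) by (meson le_add1 order_trans)
  from ex_max_orientation[of D0 ?P ?f, OF D0(1) this] obtain D
    where D: "orientation E D" "?P D"
    and max: "\<And>D'. orientation E D' \<Longrightarrow> ?P D' \<Longrightarrow> ?f D' \<le> ?f D"
    by blast
  have "out_deg D b = k + 3" if b: "b \<in> Large" for b
  proof (rule ccontr)
    assume "out_deg D b \<noteq> k + 3"
    then have lt: "out_deg D b < k + 3"
      using D(2) b Large_subset by fastforce
    also have "k + 3 \<le> card (nbrs b)" using b by (simp add: Large_def)
    finally have "\<not> nbrs b \<subseteq> {w. (b, w) \<in> D}"
      unfolding out_deg_def using card_mono[OF finite_out[OF D(1)]] by (metis not_le)
    then obtain a where a: "a \<in> nbrs b" "(b, a) \<notin> D" by blast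
    then have arc: "(a, b) \<in> D"
      using arc_total[OF D(1)] by (auto simp: nbrs_def)
    have aA: "a \<in> A" "b \<in> B" using a b Large_subset nbrs_B by auto
    define D' where "D' = reverse_arcs D {(a, b)}"
    note D' = flip_arc[OF D(1) arc, folded D'_def]
    have le: "out_deg D' w \<le> out_deg D w" if "w \<noteq> b" for w
      using D' that by (cases "w = a") auto
    have P: "?P D'"
    proof (intro conjI ballI)
      show "out_deg D' w \<le> k + 2" if "w \<in> A" for w
        using le[of w] D(2) that aA parts(2) by (metis disjoint_iff order_trans)
      show "out_deg D' w \<le> k + 3" if "w \<in> B" for w
        using le[of w] D(2) that D'(3) lt by (cases "w = b") (auto intro: order_trans)
    qed
    have "?f D < ?f D'"
    proof (rule sum_strict_mono_ex1)
      show "finite Large" using Large_subset finite_parts finite_subset by blast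
      show "\<forall>w\<in>Large. out_deg D w \<le> out_deg D' w"
        using D'(3,4) aA Large_subset parts(2)
        by (metis disjoint_iff le_add1 order_refl subsetD)
      show "\<exists>w\<in>Large. out_deg D w < out_deg D' w"
        using D'(3) b by (intro bexI[of _ b]) auto
    qed
    then show False using max[OF D'(1) P] by simp
  qed
  then show ?thesis using D unfolding feasible_def by blast
qed

lemma ex_saturated: "\<exists>D. saturated D"
proof -
  obtain D0 where D0: "feasible D0" using ex_feasible by blast
  then have "orientation E D0" by (simp add: feasible_def)
  from ex_max_orientation[of D0 feasible "\<lambda>D. \<Sum>a\<in>A. out_deg D a", OF this D0] show ?thesis
    unfolding saturated_def by (metis feasible_def)
qed

text \<open>Reversing such a path would move a unit of out-degree from \<open>B\<close> into \<open>A\<close>.\<close>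

lemma saturated_no_path:
  assumes D: "saturated D" and b: "b \<in> B - Large" and a: "a \<in> A" and path: "(b, a) \<in> D\<^sup>*"
  shows "out_deg D a = k + 2"
proof (rule ccontr)
  assume "out_deg D a \<noteq> k + 2"
  note feas = feasibleD[OF saturated_feasible[OF D]]
  have lt: "out_deg D a < k + 2"
    using feas(2)[OF a] \<open>out_deg D a \<noteq> k + 2\<close> by simp
  have o: "orientation E D" by (rule feas(1))
  have neq: "b \<noteq> a" using a b parts(2) by auto
  from shift_along_path[OF o path neq] obtain D' where D': "orientation E D'"
    "out_deg D' b + 1 = out_deg D b" "out_deg D' a = out_deg D a + 1"
    "\<And>v. v \<noteq> b \<Longrightarrow> v \<noteq> a \<Longrightarrow> out_deg D' v = out_deg D v"
    by blast
  have same: "out_deg D' v = out_deg D v" if "v \<in> A \<union> Large" "v \<noteq> a" for v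
    using that b parts(2) by (intro D'(4)) auto
  have "feasible D'"
    unfolding feasible_def
  proof (intro conjI ballI)
    show "out_deg D' w \<le> k + 2" if "w \<in> A" for w
      using feas(2)[of w] same[of w] that lt D'(3) by (cases "w = a") auto
    show "out_deg D' w = k + 3" if "w \<in> Large" for w
      using feas(3)[of w] same[of w] that a Large_subset parts(2) by auto
  qed (rule D'(1))
  moreover have "(\<Sum>v\<in>A. out_deg D v) < (\<Sum>v\<in>A. out_deg D' v)"
  proof (rule sum_strict_mono_ex1)
    show "\<forall>v\<in>A. out_deg D v \<le> out_deg D' v"
      using same D'(3) by (metis UnI1 le_add1 order_refl)
    show "\<exists>v\<in>A. out_deg D v < out_deg D' v"
      using D'(3) a by (intro bexI[of _ a]) auto
  qed (rule finite_parts)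
  ultimately show False
    using D unfolding saturated_def by (meson not_le)
qed

text \<open>
  Let \<open>T\<close> be the set of vertices of \<open>A\<close> of out-degree \<open>k + 2\<close>. The lemma concerns the small vertices
  \<open>s\<close> of degree \<open>k + 2\<close> with at most one neighbour outside \<open>T\<close>; all their out-neighbours lie in \<open>T\<close>,
  so \<open>s\<close> has an in-arc from \<open>T\<close> iff its out-degree is less than the number of its neighbours in \<open>T\<close>.
  This rephrases the claim in terms of out-degrees alone, and shifting along paths applies. A
  violating \<open>s\<close> has out-degree at least \<open>k + 1\<close>, so it reaches some \<open>z\<close> of out-degree below \<open>k\<close>,
  which must be a small vertex of \<open>B\<close>; a shift from \<open>s\<close> to \<open>z\<close> repairs \<open>s\<close>, and \<open>z\<close> itself has too
  small an out-degree to become violating.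
\<close>

lemma ex_saturated_hitting:
  obtains D where "saturated D"
    and "\<And>s. s \<in> B - Large \<Longrightarrow> card (nbrs s) = k + 2 \<Longrightarrow>
      card {a \<in> nbrs s. out_deg D a \<noteq> k + 2} \<le> 1 \<Longrightarrow> \<exists>t. (t, s) \<in> D \<and> out_deg D t = k + 2"
proof -
  obtain D1 where D1: "saturated D1" using ex_saturated by blast
  note feas1 = feasibleD[OF saturated_feasible[OF D1]]
  define T where "T = {a \<in> A. out_deg D1 a = k + 2}"
  define S where "S = {s \<in> B - Large. card (nbrs s) = k + 2 \<and> card (nbrs s - T) \<le> 1}"
  have S_card: "k + 1 \<le> card (nbrs s \<inter> T)" if "s \<in> S" for s
    using that card_Int_Diff[OF finite_nbrs, of s T] by (auto simp: S_def)
  \<comment> \<open>Fixing the out-degrees on \<open>A\<close> and on the large vertices preserves saturation and \<open>T\<close>.\<close>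
  let ?P = "\<lambda>D. orientation E D \<and> (\<forall>v\<in>A \<union> Large. out_deg D v = out_deg D1 v)"
  let ?m = "\<lambda>D. \<Sum>s\<in>S. out_deg D s + 1 - card (nbrs s \<inter> T)"
  obtain D where D: "?P D" and min: "\<And>D'. ?P D' \<Longrightarrow> ?m D \<le> ?m D'"
    using ex_has_least_nat[of ?P D1 ?m] feas1(1) by blast
  have o: "orientation E D" and same: "\<And>v. v \<in> A \<union> Large \<Longrightarrow> out_deg D v = out_deg D1 v"
    using D by blast+
  have sum_eq: "(\<Sum>a\<in>A. out_deg D a) = (\<Sum>a\<in>A. out_deg D1 a)"
    using same by (intro sum.cong) auto
  have "feasible D"
    unfolding feasible_def using o same feas1 by simp
  then have sat: "saturated D"
    using D1 unfolding saturated_def sum_eq by blast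
  have T: "T = {a \<in> A. out_deg D a = k + 2}"
    using same by (auto simp: T_def)
  have "\<exists>t. (t, s) \<in> D \<and> out_deg D t = k + 2" if s: "s \<in> S" for s
  proof (rule ccontr)
    assume none: "\<not> (\<exists>t. (t, s) \<in> D \<and> out_deg D t = k + 2)"
    have sB: "s \<in> B - Large" using s by (simp add: S_def)
    have "nbrs s \<inter> T \<subseteq> {w. (s, w) \<in> D}"
    proof
      fix t assume "t \<in> nbrs s \<inter> T"
      then show "t \<in> {w. (s, w) \<in> D}"
        using none arc_total[OF o, of s t] by (auto simp: nbrs_def T)
    qed
    then have ge: "card (nbrs s \<inter> T) \<le> out_deg D s"
      unfolding out_deg_def using finite_out[OF o] by (intro card_mono) auto
    then have "k < out_deg D s" using S_card[OF s] by simp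
    from ex_reachable_small_out_deg[OF o sparse this]
    obtain z where z: "(s, z) \<in> D\<^sup>*" "out_deg D z < k" .
    have neq: "s \<noteq> z" using z(2) \<open>k < out_deg D s\<close> by auto
    have zV: "z \<in> V"
      using rtranclE[OF z(1)] neq orientation_subset[OF o] by (metis SigmaD2 subsetD)
    have "z \<notin> A"
      using saturated_no_path[OF sat sB _ z(1)] z(2) by auto
    moreover have "z \<notin> Large"
      using feasibleD(3)[OF saturated_feasible[OF sat], of z] z(2) by auto
    ultimately have zB: "z \<in> B - Large" using zV parts(1) by blast
    from shift_along_path[OF o z(1) neq] obtain D' where D': "orientation E D'"
      "out_deg D' s + 1 = out_deg D s" "out_deg D' z = out_deg D z + 1"
      "\<And>v. v \<noteq> s \<Longrightarrow> v \<noteq> z \<Longrightarrow> out_deg D' v = out_deg D v"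
      by blast
    have "out_deg D' v = out_deg D v" if "v \<in> A \<union> Large" for v
      using that sB zB parts(2) by (intro D'(4)) auto
    then have P: "?P D'" using same D'(1) by simp
    have "?m D' < ?m D"
    proof (rule sum_strict_mono_ex1)
      show "finite S" unfolding S_def using finite_parts by simp
      show "\<forall>w\<in>S. out_deg D' w + 1 - card (nbrs w \<inter> T) \<le> out_deg D w + 1 - card (nbrs w \<inter> T)"
      proof
        fix w assume w: "w \<in> S"
        show "out_deg D' w + 1 - card (nbrs w \<inter> T) \<le> out_deg D w + 1 - card (nbrs w \<inter> T)"
          using D' z(2) S_card[OF w] by (cases "w = s"; cases "w = z") auto
      qed
      show "\<exists>w\<in>S. out_deg D' w + 1 - card (nbrs w \<inter> T) < out_deg D w + 1 - card (nbrs w \<inter> T)"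
        using D'(2) ge s by (intro bexI[of _ s]) auto
    qed
    then show False using min[OF P] by simp
  qed
  moreover have "s \<in> S" if "s \<in> B - Large" "card (nbrs s) = k + 2"
    "card {a \<in> nbrs s. out_deg D a \<noteq> k + 2} \<le> 1" for s
  proof -
    have "nbrs s - T = {a \<in> nbrs s. out_deg D a \<noteq> k + 2}"
      using that nbrs_B by (auto simp: T)
    then show ?thesis using that by (simp add: S_def)
  qed
  ultimately show thesis using that sat by blast
qed

text \<open>
  The out-degrees in the final orientation are as follows; the names are those of the proof, and the
  set \<open>A\<close> is the union of \<open>T\<close>, \<open>R\<close> and \<open>Y\<close>, while \<open>B\<close> is the union of \<open>Large\<close>, \<open>U1\<close>, \<open>U - U1\<close>
  and \<open>W\<close>.
  \<^item> \<open>T\<close>: \<open>k + 2\<close>.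
  \<^item> \<open>R\<close>, the safe vertices: at most \<open>k\<close>.
  \<^item> \<open>Y\<close>, the unsafe vertices: \<open>k + 1\<close>, with all edges to small vertices directed outwards.
  \<^item> \<open>Large\<close>: \<open>k + 3\<close>.
  \<^item> \<open>U1\<close>, adjacent to \<open>R\<close> but not to \<open>Y\<close>: \<open>k + 1\<close>.
  \<^item> \<open>U - U1\<close>, adjacent to \<open>Y\<close> but not to \<open>R\<close>: at most \<open>k\<close>.
  \<^item> \<open>W\<close>, the other small vertices: at most \<open>k + 1\<close>, and at most \<open>k\<close> next to a vertex of \<open>Y\<close>.

  The only edges that these values leave open are those between \<open>R\<close> and \<open>W\<close>. They form the set \<open>F\<close>
  on which the sum of squares decides, and the bounds hold whatever happens there: the bound on \<open>R\<close>
  since its vertices start out with all edges to small vertices directed outwards, and the bound on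
  \<open>W\<close> by degree alone, together with a frozen in-arc from \<open>T\<close> for degree \<open>k + 2\<close>.
\<close>

lemma ex_proper_orientation:
  obtains D where "proper_orientation E D" and "\<And>v. v \<in> V \<Longrightarrow> out_deg D v \<le> k + 3"
proof -
  obtain D0 where D0: "saturated D0"
    and hit: "\<And>s. s \<in> B - Large \<Longrightarrow> card (nbrs s) = k + 2 \<Longrightarrow>
      card {a \<in> nbrs s. out_deg D0 a \<noteq> k + 2} \<le> 1 \<Longrightarrow> \<exists>t. (t, s) \<in> D0 \<and> out_deg D0 t = k + 2"
    using ex_saturated_hitting by blast
  note feas = feasibleD[OF saturated_feasible[OF D0]]
  note o0 = feas(1)
  define T where "T = {a \<in> A. out_deg D0 a = k + 2}"
  define N where "N s = nbrs s - T" for s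
  define U where "U = {s \<in> B - Large. card (nbrs s) = k + 2 \<and> (\<forall>t\<in>T. (t, s) \<notin> D0)}"
  define R0 where "R0 = {a \<in> A. out_deg D0 a \<le> k}"
  have N_A: "N s \<subseteq> A - T" if "s \<in> B" for s
    using that nbrs_B by (auto simp: N_def)
  have U_B: "U \<subseteq> B - Large" by (auto simp: U_def)
  obtain R p where R: "R0 \<subseteq> R" "R \<subseteq> R0 \<union> (\<Union>s\<in>U. N s)"
    and closed: "\<And>s. s \<in> U \<Longrightarrow> N s \<inter> R \<noteq> {} \<Longrightarrow> N s \<subseteq> R \<and> p s \<in> N s"
    and escape: "\<And>a. a \<in> R - R0 \<Longrightarrow> \<exists>s\<in>U. a \<in> N s \<and> p s \<noteq> a"
    using ex_escape_parents[where ?R0.0 = R0 and U = U and N = N] by metis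
  have R_A: "R \<subseteq> A - T"
    using R(2) N_A U_B by (force simp: R0_def T_def)
  define Y where "Y = A - T - R"
  define U1 where "U1 = {s \<in> U. N s \<inter> R \<noteq> {}}"
  define X where "X = {(a, s) \<in> D0. a \<in> A - T \<and> s \<in> U1 \<and> a \<noteq> p s}"
  define D1 where "D1 = reverse_arcs D0 X"
  define F where "F = {e \<in> E. \<exists>a\<in>R. \<exists>w\<in>B - Large - U. e = {a, w}}"
  have o1: "orientation E D1"
    unfolding D1_def using o0 by (rule orientation_reverse_arcs) (auto simp: X_def)
  have "F \<subseteq> E" by (auto simp: F_def)
  from ex_orientation_proper_on[OF o1 this] obtain D where o: "orientation E D"
    and frozen: "\<And>u v. {u, v} \<notin> F \<Longrightarrow> (u, v) \<in> D \<longleftrightarrow> (u, v) \<in> D1"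
    and proper_F: "\<And>u v. {u, v} \<in> F \<Longrightarrow> out_deg D u \<noteq> out_deg D v"
    by blast
  have F_iff: "{a, b} \<in> F \<longleftrightarrow> {a, b} \<in> E \<and> a \<in> R \<and> b \<in> B - Large - U" if "a \<in> A" "b \<in> B" for a b
    using that R_A parts(2) by (auto simp: F_def doubleton_eq_iff)
  have F_iff': "{b, a} \<in> F \<longleftrightarrow> {a, b} \<in> E \<and> a \<in> R \<and> b \<in> B - Large - U" if "a \<in> A" "b \<in> B" for a b
    using F_iff[OF that] by (simp add: insert_commute)
  have AB: "a \<noteq> b" if "a \<in> A" "b \<in> B" for a b
    using that parts(2) by blast
  have U1_U: "U1 \<subseteq> U" by (auto simp: U1_def)
  have X_iff: "(a, b) \<in> X \<longleftrightarrow> (a, b) \<in> D0 \<and> a \<notin> T \<and> b \<in> U1 \<and> a \<noteq> p b" "(b, a) \<notin> X"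
    if "a \<in> A" "b \<in> B" for a b
    using that parts(2) U1_U U_B by (auto simp: X_def)
  have D1_iff: "(a, b) \<in> D1 \<longleftrightarrow> (a, b) \<in> D0 \<and> (a, b) \<notin> X"
    "(b, a) \<in> D1 \<longleftrightarrow> (b, a) \<in> D0 \<or> (a, b) \<in> X" if "a \<in> A" "b \<in> B" for a b
    using X_iff[OF that] by (auto simp: D1_def reverse_arcs_def)

  \<comment> \<open>By saturation, each vertex of \<open>A - T\<close> is a source towards the small vertices of \<open>B\<close>.\<close>
  have inward: "(a, b) \<in> D0" if "a \<in> A - T" "b \<in> B - Large" "{a, b} \<in> E" for a b
  proof (rule ccontr)
    assume "(a, b) \<notin> D0"
    then have "(b, a) \<in> D0" using arc_total[OF o0] that by blast
    then show False
      using saturated_no_path[OF D0, of b a] that by (auto simp: T_def)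
  qed

  have U1_R: "a \<in> R" if "b \<in> U1" "a \<in> A - T" "{a, b} \<in> E" for a b
    using that closed[of b] U1_U nbrs_def N_def by (auto simp: U1_def insert_commute)
  have unchanged: "(a, b) \<in> D \<longleftrightarrow> (a, b) \<in> D0" "(b, a) \<in> D \<longleftrightarrow> (b, a) \<in> D0"
    if "a \<in> A" "b \<in> B" "a \<in> T \<union> Y \<or> b \<in> Large" for a b
  proof -
    have "{a, b} \<notin> F" "{b, a} \<notin> F"
      using that R_A by (auto simp: F_iff F_iff' Y_def)
    moreover have "(a, b) \<notin> X"
      using that U1_R[of b a] arc_edge[OF o0, of a b] U1_U U_B X_iff[OF that(1,2)]
      by (auto simp: Y_def)
    ultimately show "(a, b) \<in> D \<longleftrightarrow> (a, b) \<in> D0" "(b, a) \<in> D \<longleftrightarrow> (b, a) \<in> D0"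
      using frozen D1_iff[OF that(1,2)] by auto
  qed
  have out_A: "out_deg D a = out_deg D0 a" if "a \<in> T \<union> Y" for a
  proof -
    have aA: "a \<in> A" using that by (auto simp: T_def Y_def)
    have "(a, w) \<in> D \<longleftrightarrow> (a, w) \<in> D0" for w
      using unchanged(1)[OF aA, of w] that nbrs_A[OF aA, of w] out_subset_nbrs[OF o, of a]
        out_subset_nbrs[OF o0, of a] by blast
    then show ?thesis by (simp add: out_deg_def)
  qed
  have out_T: "out_deg D a = k + 2" if "a \<in> T" for a
    using that out_A by (auto simp: T_def)
  have out_Y: "out_deg D a = k + 1" if "a \<in> Y" for a
  proof -
    have "a \<in> A" "a \<notin> T" "a \<notin> R0" using that R(1) by (auto simp: Y_def)
    then have "k < out_deg D0 a" "out_deg D0 a \<noteq> k + 2" "out_deg D0 a \<le> k + 2"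
      using feas(2) by (auto simp: R0_def T_def)
    then show ?thesis using out_A that by simp
  qed
  have out_Large: "out_deg D b = k + 3" if b: "b \<in> Large" for b
  proof -
    have bB: "b \<in> B" using b Large_subset by blast
    have "(b, w) \<in> D \<longleftrightarrow> (b, w) \<in> D0" for w
      using unchanged(2)[OF _ bB, of w] b nbrs_B[OF bB, of w] out_subset_nbrs[OF o, of b]
        out_subset_nbrs[OF o0, of b] by blast
    then show ?thesis using feas(3)[OF b] by (simp add: out_deg_def)
  qed
  have U1_arc: "(a, s) \<in> D \<longleftrightarrow> a = p s" if "s \<in> U1" "a \<in> N s" for a s
  proof -
    have s: "s \<in> B" "s \<in> B - Large" "s \<in> U" using that U1_U U_B by auto
    have a: "a \<in> A" "a \<in> A - T" "{a, s} \<in> E"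
      using that N_A[OF s(1)] by (auto simp: N_def nbrs_def insert_commute)
    have "{a, s} \<notin> F" using F_iff[OF a(1) s(1)] s by simp
    then show ?thesis
      using frozen D1_iff[OF a(1) s(1)] X_iff[OF a(1) s(1)] inward[OF a(2) s(2) a(3)] a(2) that(1)
      by auto
  qed

  have out_R: "out_deg D a \<le> k" if a: "a \<in> R" for a
  proof -
    have aA: "a \<in> A - T" "a \<in> A" using a R_A by auto
    \<comment> \<open>Edges to small vertices already pointed outwards and edges to large ones are frozen, so \<open>a\<close>
      can only have lost out-neighbours.\<close>
    have sub: "{w. (a, w) \<in> D} \<subseteq> {w. (a, w) \<in> D0}"
    proof
      fix w assume "w \<in> {w. (a, w) \<in> D}"
      then have w: "(a, w) \<in> D" "{a, w} \<in> E" using arc_edge[OF o] by auto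
      then have "w \<in> B" using nbrs_A aA(2) by (auto simp: nbrs_def)
      then show "w \<in> {w. (a, w) \<in> D0}"
        using inward[OF aA(1), of w] unchanged(1)[OF aA(2), of w] w by blast
    qed
    have fin: "finite {w. (a, w) \<in> D0}" by (rule finite_out[OF o0])
    show ?thesis
    proof (cases "a \<in> R0")
      case True
      then show ?thesis
        using card_mono[OF fin sub] by (simp add: R0_def out_deg_def)
    next
      case False
      \<comment> \<open>Initially \<open>a\<close> had \<open>k + 1\<close> out-neighbours, and it has lost the vertex \<open>s\<close> that made it safe.\<close>
      then obtain s where s: "s \<in> U" "a \<in> N s" "p s \<noteq> a"
        using escape a by blast
      then have s1: "s \<in> U1" using a by (auto simp: U1_def)
      have "(a, s) \<in> D0"
        using inward[OF aA(1), of s] s U_B by (auto simp: N_def nbrs_def insert_commute)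
      moreover have "(a, s) \<notin> D" using U1_arc[OF s1 s(2)] s(3) by simp
      ultimately have "{w. (a, w) \<in> D} \<subset> {w. (a, w) \<in> D0}" using sub by blast
      then have "out_deg D a < out_deg D0 a"
        unfolding out_deg_def using fin by (rule psubset_card_mono[rotated])
      moreover have "out_deg D0 a \<le> k + 2" "out_deg D0 a \<noteq> k + 2"
        using feas(2)[OF aA(2)] aA by (auto simp: T_def)
      ultimately show ?thesis by simp
    qed
  qed

  have U_T: "(s, t) \<in> D" if "s \<in> U" "t \<in> T" "{t, s} \<in> E" for s t
  proof -
    have "(t, s) \<notin> D0" using that by (auto simp: U_def)
    then have "(s, t) \<in> D0" using arc_total[OF o0] that by blast
    then show ?thesis
      using unchanged(2)[of t s] that U_B by (auto simp: T_def)
  qed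
  have out_U1: "out_deg D s = k + 1" if s: "s \<in> U1" for s
  proof -
    have sU: "s \<in> U" "s \<in> B" using s U1_U U_B by auto
    have p: "p s \<in> N s" using closed[of s] s by (auto simp: U1_def)
    have "{w. (s, w) \<in> D} = nbrs s - {p s}"
    proof (intro set_eqI iffI)
      fix w assume "w \<in> {w. (s, w) \<in> D}"
      then show "w \<in> nbrs s - {p s}"
        using out_subset_nbrs[OF o, of s] U1_arc[OF s p] arc_asym[OF o, of s w] by auto
    next
      fix w assume w: "w \<in> nbrs s - {p s}"
      then have e: "{w, s} \<in> E" "{s, w} \<in> E" by (auto simp: nbrs_def insert_commute)
      show "w \<in> {w. (s, w) \<in> D}"
      proof (cases "w \<in> T")
        case True
        then show ?thesis using U_T[OF sU(1) _ e(1)] by simp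
      next
        case False
        then have "w \<in> N s" using w by (simp add: N_def)
        then have "(w, s) \<notin> D" using U1_arc[OF s] w by auto
        then show ?thesis using arc_total[OF o e(1)] by simp
      qed
    qed
    then show ?thesis
      using p finite_nbrs[of s] sU(1) by (simp add: out_deg_def N_def U_def)
  qed
  have out_U: "out_deg D s \<le> k" if s: "s \<in> U - U1" for s
  proof -
    have sU: "s \<in> U" "s \<in> B" "s \<in> B - Large" using s U_B by auto
    have "(a, s) \<in> D" if a: "a \<in> N s" for a
    proof -
      have "a \<in> Y" using a s N_A[OF sU(2)] by (auto simp: U1_def Y_def)
      then show ?thesis
        using unchanged(1)[of a s] inward[of a s] a sU
        by (auto simp: Y_def N_def nbrs_def insert_commute)
    qed
    then have le: "out_deg D s + card (N s) \<le> card (nbrs s)"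
      by (rule out_deg_le_in[OF o])
    \<comment> \<open>Here the choice of \<open>D0\<close> enters: \<open>s\<close> loses at least two of its \<open>k + 2\<close> edges.\<close>
    have "\<not> card (N s) \<le> 1"
    proof
      assume "card (N s) \<le> 1"
      moreover have "N s = {a \<in> nbrs s. out_deg D0 a \<noteq> k + 2}"
        using nbrs_B[OF sU(2)] by (auto simp: N_def T_def)
      ultimately obtain t where t: "(t, s) \<in> D0" "out_deg D0 t = k + 2"
        using hit[of s] sU by (auto simp: U_def)
      then have "t \<in> A"
        using nbrs_B[OF sU(2), of t] arc_edge[OF o0 t(1)] by (simp add: nbrs_def insert_commute)
      then show False using t sU(1) by (auto simp: U_def T_def)
    qed
    then show ?thesis using le sU(1) by (simp add: U_def)
  qed
  define W where "W = B - Large - U"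
  \<comment> \<open>The set \<open>I\<close> will be empty or consist of one vertex of \<open>Y\<close> adjacent to \<open>w\<close>.\<close>
  have W_I: "out_deg D w + card I \<le> k + 1" if w: "w \<in> W" and I: "\<And>y. y \<in> I \<Longrightarrow> y \<in> Y \<and> {y, w} \<in> E" for w I
  proof -
    have wB: "w \<in> B" "w \<in> B - Large" using w by (auto simp: W_def)
    have arc: "(y, w) \<in> D" if "y \<in> I" for y
      using I[OF that] inward[of y w] unchanged(1)[of y w] wB by (auto simp: Y_def)
    have deg: "card (nbrs w) \<le> k + 2"
      using wB by (auto simp: Large_def)
    show ?thesis
    proof (cases "card (nbrs w) = k + 2")
      case False
      moreover have "out_deg D w + card I \<le> card (nbrs w)"
        using arc by (rule out_deg_le_in[OF o])
      ultimately show ?thesis using deg by linarith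
    next
      case True
      then obtain t where t: "t \<in> T" "(t, w) \<in> D0"
        using w by (auto simp: W_def U_def)
      then have "(t, w) \<in> D" using unchanged(1)[of t w] wB by (auto simp: T_def)
      then have "out_deg D w + card (insert t I) \<le> card (nbrs w)"
        using arc by (intro out_deg_le_in[OF o]) auto
      moreover have "t \<notin> I" using t I by (auto simp: Y_def)
      moreover have "finite I"
        using I finite_parts(1) by (intro finite_subset[of I A]) (auto simp: Y_def)
      ultimately show ?thesis using True by simp
    qed
  qed
  have out_W: "out_deg D w \<le> k + 1" if "w \<in> W" for w
    using W_I[OF that, of "{}"] by simp

  have ineq: "out_deg D a \<noteq> out_deg D b" if ab: "a \<in> A" "b \<in> B" and e: "{a, b} \<in> E" for a b
  proof -
    consider (T) "a \<in> T" | (Y) "a \<in> Y" | (R) "a \<in> R" using ab by (auto simp: Y_def)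
    then show ?thesis
    proof cases
      case T
      consider "b \<in> Large" | "b \<in> U1" | "b \<in> U - U1" | "b \<in> W" using ab by (auto simp: W_def)
      then show ?thesis
        using out_T[OF T] out_Large[of b] out_U1[of b] out_U[of b] out_W[of b] by cases auto
    next
      case Y
      have "b \<notin> U1" using U1_R[of b a] e Y by (auto simp: Y_def)
      then consider "b \<in> Large" | "b \<in> U - U1" | "b \<in> W" using ab by (auto simp: W_def)
      then show ?thesis
        using out_Y[OF Y] out_Large[of b] out_U[of b] W_I[of b "{a}"] Y e by cases auto
    next
      case R
      have "b \<notin> U - U1"
      proof
        assume b: "b \<in> U - U1"
        have "a \<in> N b" using R R_A e by (auto simp: N_def nbrs_def insert_commute)
        then show False using b R by (auto simp: U1_def)
      qed
      then consider "b \<in> Large" | "b \<in> U1" | "b \<in> W" using ab by (auto simp: W_def)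
      then show ?thesis
      proof cases
        case 3
        then have "{a, b} \<in> F" using F_iff[OF ab] e R by (simp add: W_def)
        then show ?thesis by (rule proper_F)
      qed (use out_R[OF R] out_Large[of b] out_U1[of b] in auto)
    qed
  qed
  have "proper_orientation E D"
    unfolding proper_orientation_def
  proof (intro conjI allI impI)
    fix u v assume e: "{u, v} \<in> E"
    then obtain a b where "a \<in> A" "b \<in> B" "{u, v} = {a, b}"
      using bipartite by blast
    then show "out_deg D u \<noteq> out_deg D v"
      using ineq[of a b] e by (metis doubleton_eq_iff)
  qed (rule o)
  moreover have "out_deg D v \<le> k + 3" if vV: "v \<in> V" for v
  proof -
    consider "v \<in> T" | "v \<in> Y" | "v \<in> R" | "v \<in> Large" | "v \<in> U1" | "v \<in> U - U1" | "v \<in> W"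
      using vV unfolding parts(1)[symmetric] W_def Y_def by blast
    then show ?thesis
      using out_T[of v] out_Y[of v] out_R[of v] out_Large[of v] out_U1[of v] out_U[of v] out_W[of v]
      by cases auto
  qed
  ultimately show thesis using that by blast
qed

end

section \<open>The maximum average degree\<close>

context finite_simple_graph
begin

text \<open>
  \<open>D\<close> may direct an edge both ways, which allows a convenient choice of arcs where an upper bound on
  the number of edges is all that matters.
\<close>

lemma subgraph_card_le:
  assumes "subgraph_of V' E' V E"
    and cover: "\<And>u v. {u, v} \<in> E \<Longrightarrow> (u, v) \<in> D \<or> (v, u) \<in> D"
    and out: "\<And>v. v \<in> V \<Longrightarrow> finite {w. (v, w) \<in> D} \<and> out_deg D v \<le> c"
  shows "card E' \<le> c * card V'"
proof -
  have sub: "V' \<subseteq> V" "E' \<subseteq> E" "\<And>e. e \<in> E' \<Longrightarrow> e \<subseteq> V'" and fin: "finite V'"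
    using assms(1) by (auto simp: subgraph_of_def simple_graph_def)
  let ?S = "SIGMA v:V'. {w. (v, w) \<in> D}"
  have finS: "finite ?S"
    using fin out sub(1) by (intro finite_SigmaI) auto
  have "E' \<subseteq> (\<lambda>(u, v). {u, v}) ` ?S"
  proof
    fix e assume e: "e \<in> E'"
    then obtain u v where uv: "e = {u, v}" using edge_cases sub(2) by blast
    then have "u \<in> V'" "v \<in> V'" using sub(3)[OF e] by auto
    moreover have "(u, v) \<in> D \<or> (v, u) \<in> D" using cover e sub(2) uv by blast
    moreover have "e = {v, u}" using uv by blast
    ultimately show "e \<in> (\<lambda>(u, v). {u, v}) ` ?S" using uv by force
  qed
  then have "card E' \<le> card ?S"
    using finS by (rule surj_card_le[rotated])
  also have "\<dots> = (\<Sum>v\<in>V'. out_deg D v)"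
    unfolding out_deg_def using fin out sub(1) by (intro card_SigmaI) auto
  also have "\<dots> \<le> (\<Sum>v\<in>V'. c)"
    using out sub(1) by (intro sum_mono) auto
  finally show ?thesis by (simp add: mult.commute)
qed

lemma finite_mad_set: "finite {2 * real (card E') / real (card V') | V' E'. subgraph_of V' E' V E}"
proof (rule finite_subset)
  show "{2 * real (card E') / real (card V') | V' E'. subgraph_of V' E' V E}
    \<subseteq> (\<lambda>(V', E'). 2 * real (card E') / real (card V')) ` (Pow V \<times> Pow E)"
    by (auto simp: subgraph_of_def)
qed (use finite_V finite_E in auto)

lemma edges_le_mad:
  assumes "subgraph_of V' E' V E"
  shows "real (card E') \<le> mad V E / 2 * real (card V')"
proof -
  have "2 * real (card E') / real (card V') \<le> mad V E"
    unfolding mad_def using assms finite_mad_set by (intro Max_ge) auto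
  moreover have "card V' > 0"
    using assms by (auto simp: subgraph_of_def simple_graph_def card_gt_0_iff)
  ultimately show ?thesis by (simp add: field_simps)
qed

lemma mad_le:
  assumes "\<And>V' E'. subgraph_of V' E' V E \<Longrightarrow> card E' \<le> c * card V'"
  shows "mad V E / 2 \<le> real c"
proof -
  have "mad V E \<le> 2 * real c"
    unfolding mad_def
  proof (rule Max.boundedI)
    have "subgraph_of V {} V E"
      using simple by (auto simp: subgraph_of_def simple_graph_def)
    then show "{2 * real (card E') / real (card V') | V' E'. subgraph_of V' E' V E} \<noteq> {}" by blast
  next
    fix x assume "x \<in> {2 * real (card E') / real (card V') | V' E'. subgraph_of V' E' V E}"
    then obtain V' E' where x: "x = 2 * real (card E') / real (card V')" and sub: "subgraph_of V' E' V E"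
      by blast
    have "card V' > 0"
      using sub by (auto simp: subgraph_of_def simple_graph_def card_gt_0_iff)
    moreover have "real (card E') \<le> real c * real (card V')"
      using assms[OF sub] by (metis of_nat_le_iff of_nat_mult)
    ultimately show "x \<le> 2 * real c" unfolding x by (simp add: field_simps)
  qed (rule finite_mad_set)
  then show ?thesis by simp
qed

lemma edges_within_le:
  assumes "X \<subseteq> V"
  shows "card {e \<in> E. e \<subseteq> X} \<le> nat \<lceil>mad V E / 2\<rceil> * card X"
proof (cases "X = {}")
  case True
  have "{e \<in> E. e \<subseteq> {}} = {}" using simple by (auto simp: simple_graph_def)
  then show ?thesis using True by simp
next
  case False
  have "finite X" using assms finite_V by (rule finite_subset)
  then have "subgraph_of X {e \<in> E. e \<subseteq> X} V E"
    using False assms simple by (auto simp: subgraph_of_def simple_graph_def)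
  from edges_le_mad[OF this]
  have "real (card {e \<in> E. e \<subseteq> X}) \<le> mad V E / 2 * real (card X)" .
  also have "\<dots> \<le> real (nat \<lceil>mad V E / 2\<rceil>) * real (card X)"
    by (intro mult_right_mono) linarith+
  finally show ?thesis by (metis of_nat_le_iff of_nat_mult)
qed

lemma mad_nonneg: "0 \<le> mad V E"
proof -
  have "subgraph_of V {} V E"
    using simple by (auto simp: subgraph_of_def simple_graph_def)
  from edges_le_mad[OF this] have "0 \<le> mad V E * real (card V)" by simp
  moreover have "0 < real (card V)"
    using simple by (simp add: simple_graph_def card_gt_0_iff)
  ultimately show ?thesis by (simp add: zero_le_mult_iff)
qed

section \<open>The proper orientation number\<close>

lemma proper_orientation_number_le:
  assumes "proper_orientation E D" and "\<And>v. v \<in> V \<Longrightarrow> out_deg D v \<le> m"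
  shows "proper_orientation_number V E \<le> m"
proof -
  have "proper_orientation_number V E \<le> Max (out_deg D ` V)"
    unfolding proper_orientation_number_def using assms(1) by (intro Least_le) blast
  also have "\<dots> \<le> m"
    using assms(2) simple by (intro Max.boundedI) (auto simp: simple_graph_def)
  finally show ?thesis .
qed

lemma proper_orientation_number_attained:
  obtains D where "proper_orientation E D"
    and "\<And>v. v \<in> V \<Longrightarrow> out_deg D v \<le> proper_orientation_number V E"
proof -
  obtain D0 where "orientation E D0" using ex_orientation by blast
  from ex_orientation_proper_on[OF this subset_refl]
  obtain D1 where "proper_orientation E D1" unfolding proper_orientation_def by metis
  then have "\<exists>m D. proper_orientation E D \<and> Max (out_deg D ` V) = m" by blast
  then have "\<exists>D. proper_orientation E D \<and> Max (out_deg D ` V) = proper_orientation_number V E"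
    unfolding proper_orientation_number_def by (rule LeastI_ex)
  then obtain D where "proper_orientation E D" "Max (out_deg D ` V) = proper_orientation_number V E"
    by blast
  then show thesis
    using that finite_V by (metis Max_ge finite_imageI imageI)
qed

lemma mad_le_proper_orientation_number: "\<lceil>mad V E / 2\<rceil> \<le> int (proper_orientation_number V E)"
proof -
  obtain D where D: "proper_orientation E D"
    "\<And>v. v \<in> V \<Longrightarrow> out_deg D v \<le> proper_orientation_number V E"
    using proper_orientation_number_attained by blast
  then have o: "orientation E D" by (simp add: proper_orientation_def)
  have "mad V E / 2 \<le> real (proper_orientation_number V E)"
  proof (rule mad_le)
    fix V' E' assume "subgraph_of V' E' V E"
    then show "card E' \<le> proper_orientation_number V E * card V'"
      by (rule subgraph_card_le[where D = D]) (use arc_total[OF o] finite_out[OF o] D(2) in blast)+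
  qed
  then show ?thesis by (simp add: ceiling_le_iff)
qed

end

lemma bipartite_proper_orientation_number_le:
  assumes "bipartite_graph V E"
  shows "int (proper_orientation_number V E) \<le> \<lceil>mad V E / 2\<rceil> + 3"
proof -
  from assms obtain A B where AB: "A \<union> B = V" "A \<inter> B = {}"
    "\<And>e. e \<in> E \<Longrightarrow> \<exists>a\<in>A. \<exists>b\<in>B. e = {a, b}" and simple: "simple_graph V E"
    by (auto simp: bipartite_graph_def)
  interpret finite_simple_graph V E by standard (rule simple)
  interpret sparse_bipartite_graph V E A B "nat \<lceil>mad V E / 2\<rceil>"
    by standard (use AB edges_within_le in blast)+
  obtain D where "proper_orientation E D" "\<And>v. v \<in> V \<Longrightarrow> out_deg D v \<le> nat \<lceil>mad V E / 2\<rceil> + 3"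
    using ex_proper_orientation by blast
  then have "proper_orientation_number V E \<le> nat \<lceil>mad V E / 2\<rceil> + 3"
    by (rule proper_orientation_number_le)
  moreover have "0 \<le> \<lceil>mad V E / 2\<rceil>"
    using mad_nonneg by simp
  ultimately show ?thesis by linarith
qed

section \<open>Graphs that attain the upper bound\<close>

text \<open>
  The Boolean is the colour of the hubs to which a vertex belongs, \<open>i\<close> numbers the copies of a gadget,
  and the gadgets attached to the hub with index \<open>h\<close> are
  \<^item> \<open>Source s h j i\<close>, adjacent to the \<open>j\<close> hubs with indices \<open>h, \<dots>, h + j - 1\<close>;
  \<^item> \<open>Star s h i\<close> with its \<open>k\<close> neighbours \<open>Leaf s h i l\<close>, each of which is also adjacent to the \<open>k\<close>
    hubs with indices \<open>h, \<dots>, h + k - 1\<close>.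

  Only the hubs with index below \<open>k + 3\<close> carry gadgets and belong to the tree of hubs; the
  others complete the windows of consecutive indices.
\<close>

datatype vertex =
    Hub bool nat
  | Source bool nat nat nat
  | Star bool nat nat
  | Leaf bool nat nat nat

instance vertex :: countable
  by countable_datatype

text \<open>One more than the number of arcs that \<open>k\<close> hubs of out-degree at most \<open>k + 2\<close> can emit.\<close>

definition copies :: "nat \<Rightarrow> nat" where
  "copies k = k * (k + 2) + 1"

text \<open>
  The arcs are directed such that all out-degrees are at most \<open>k\<close>, which bounds the maximum average
  degree. In the tree of hubs, the edge between the two centres \<open>Hub True 0\<close> and \<open>Hub False 0\<close>
  appears in both directions.
\<close>

fun tight_arc :: "nat \<Rightarrow> vertex \<Rightarrow> vertex \<Rightarrow> bool" where
  "tight_arc k (Source s h j i) (Hub t m) \<longleftrightarrow>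
     t = s \<and> h < k + 3 \<and> 1 \<le> j \<and> j \<le> k \<and> i < copies k \<and> h \<le> m \<and> m < h + j"
| "tight_arc k (Leaf s h i l) (Hub t m) \<longleftrightarrow>
     t = s \<and> h < k + 3 \<and> i < copies k \<and> l < k \<and> h \<le> m \<and> m < h + k"
| "tight_arc k (Star s h i) (Leaf t h' i' l) \<longleftrightarrow>
     t = s \<and> h' = h \<and> i' = i \<and> h < k + 3 \<and> i < copies k \<and> l < k"
| "tight_arc k (Hub s m) (Hub t m') \<longleftrightarrow> t = (\<not> s) \<and> m < k + 3 \<and> m' = 0"
| "tight_arc k _ _ \<longleftrightarrow> False"

definition tight_V :: "nat \<Rightarrow> vertex set" where
  "tight_V k =
     (\<lambda>(s, m). Hub s m) ` (UNIV \<times> {..<2 * k + 3})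
   \<union> (\<lambda>(s, h, j, i). Source s h j i) ` (UNIV \<times> {..<k + 3} \<times> {1..k} \<times> {..<copies k})
   \<union> (\<lambda>(s, h, i). Star s h i) ` (UNIV \<times> {..<k + 3} \<times> {..<copies k})
   \<union> (\<lambda>(s, h, i, l). Leaf s h i l) ` (UNIV \<times> {..<k + 3} \<times> {..<copies k} \<times> {..<k})"

definition tight_E :: "nat \<Rightarrow> vertex set set" where
  "tight_E k = {{u, v} | u v. tight_arc k u v}"

fun side :: "vertex \<Rightarrow> bool" where
  "side (Hub s m) = s"
| "side (Source s h j i) = (\<not> s)"
| "side (Star s h i) = s"
| "side (Leaf s h i l) = (\<not> s)"

lemma tight_arc_side: "tight_arc k u v \<Longrightarrow> side u \<noteq> side v"
  by (cases "(k, u, v)" rule: tight_arc.cases) auto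

lemma tight_arc_V: "tight_arc k u v \<Longrightarrow> u \<in> tight_V k \<and> v \<in> tight_V k"
  by (cases "(k, u, v)" rule: tight_arc.cases) (auto simp: tight_V_def image_iff)

lemma tight_edge_iff: "{u, v} \<in> tight_E k \<longleftrightarrow> tight_arc k u v \<or> tight_arc k v u"
  by (auto simp: tight_E_def doubleton_eq_iff)

lemma tight_bipartite: "bipartite_graph (tight_V k) (tight_E k)"
  unfolding bipartite_graph_def simple_graph_def
proof (intro conjI ballI)
  show "finite (tight_V k)" by (simp add: tight_V_def)
  have "Hub True 0 \<in> tight_V k" by (auto simp: tight_V_def image_iff)
  then show "tight_V k \<noteq> {}" by blast
next
  fix e assume "e \<in> tight_E k"
  then obtain u v where e: "e = {u, v}" "tight_arc k u v" by (auto simp: tight_E_def)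
  then show "e \<subseteq> tight_V k" using tight_arc_V by auto
  have "u \<noteq> v" using tight_arc_side[OF e(2)] by auto
  then show "card e = 2" using e(1) by simp
next
  let ?A = "{v \<in> tight_V k. side v}" and ?B = "{v \<in> tight_V k. \<not> side v}"
  have "\<exists>a\<in>?A. \<exists>b\<in>?B. e = {a, b}" if e_in: "e \<in> tight_E k" for e
  proof -
    obtain u v where e: "e = {u, v}" "tight_arc k u v" using e_in by (auto simp: tight_E_def)
    note uv = tight_arc_V[OF e(2)] tight_arc_side[OF e(2)]
    show ?thesis
    proof (cases "side u")
      case True
      then show ?thesis using uv e(1) by (intro bexI[of _ u] bexI[of _ v]) auto
    next
      case False
      then show ?thesis using uv e(1) by (intro bexI[of _ v] bexI[of _ u]) auto
    qed
  qed
  then show "\<exists>A B. A \<union> B = tight_V k \<and> A \<inter> B = {} \<and> (\<forall>e\<in>tight_E k. \<exists>a\<in>A. \<exists>b\<in>B. e = {a, b})"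
    by (intro exI[of _ ?A] exI[of _ ?B]) auto
qed

lemma tight_arc_out:
  assumes "1 \<le> k"
  shows "finite {w. tight_arc k u w} \<and> card {w. tight_arc k u w} \<le> k"
proof -
  have *: ?thesis if "{w. tight_arc k u w} \<subseteq> S" "finite S" "card S \<le> k" for S
    using that by (meson card_mono finite_subset order_trans)
  show ?thesis
  proof (cases u)
    case (Hub s m)
    show ?thesis
    proof (rule *)
      show "{w. tight_arc k u w} \<subseteq> {Hub (\<not> s) 0}"
      proof
        fix w assume "w \<in> {w. tight_arc k u w}"
        then show "w \<in> {Hub (\<not> s) 0}" using Hub by (cases w) auto
      qed
    qed (use assms in auto)
  next
    case (Source s h j i)
    show ?thesis
    proof (cases "j \<le> k")
      case True
      show ?thesis
      proof (rule *)
        show "{w. tight_arc k u w} \<subseteq> Hub s ` {h..<h + j}"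
        proof
          fix w assume "w \<in> {w. tight_arc k u w}"
          then show "w \<in> Hub s ` {h..<h + j}" using Source by (cases w) auto
        qed
        show "card (Hub s ` {h..<h + j}) \<le> k"
          using True by (simp add: card_image inj_on_def)
      qed simp
    next
      case False
      show ?thesis
      proof (rule *)
        show "{w. tight_arc k u w} \<subseteq> {}"
        proof
          fix w assume "w \<in> {w. tight_arc k u w}"
          then show "w \<in> {}" using Source False by (cases w) auto
        qed
      qed auto
    qed
  next
    case (Star s h i)
    show ?thesis
    proof (rule *)
      show "{w. tight_arc k u w} \<subseteq> Leaf s h i ` {..<k}"
      proof
        fix w assume "w \<in> {w. tight_arc k u w}"
        then show "w \<in> Leaf s h i ` {..<k}" using Star by (cases w) auto
      qed
      show "card (Leaf s h i ` {..<k}) \<le> k"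
        by (simp add: card_image inj_on_def)
    qed simp
  next
    case (Leaf s h i l)
    show ?thesis
    proof (rule *)
      show "{w. tight_arc k u w} \<subseteq> Hub s ` {h..<h + k}"
      proof
        fix w assume "w \<in> {w. tight_arc k u w}"
        then show "w \<in> Hub s ` {h..<h + k}" using Leaf by (cases w) auto
      qed
      show "card (Hub s ` {h..<h + k}) \<le> k"
        by (simp add: card_image inj_on_def)
    qed simp
  qed
qed

text \<open>Each block that is hit uses up an arc leaving \<open>J\<close> of its own.\<close>

lemma (in finite_simple_graph) ex_unhit_block:
  assumes P: "orientation E P" and J: "finite J" "\<And>v. v \<in> J \<Longrightarrow> out_deg P v \<le> c"
    and n: "card J * c < n"
    and disj: "\<And>i i' x. x \<in> X i \<Longrightarrow> x \<in> X i' \<Longrightarrow> i = i'"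
  obtains i where "i < n" and "\<And>v x. v \<in> J \<Longrightarrow> x \<in> X i \<Longrightarrow> (v, x) \<notin> P"
proof (rule ccontr)
  assume "\<not> thesis"
  then have "\<forall>i\<in>{..<n}. \<exists>a. a \<in> (SIGMA v:J. {x. (v, x) \<in> P}) \<and> snd a \<in> X i"
    using that by fastforce
  then obtain g where g: "\<And>i. i < n \<Longrightarrow> g i \<in> (SIGMA v:J. {x. (v, x) \<in> P}) \<and> snd (g i) \<in> X i"
    by (metis lessThan_iff)
  have "inj_on g {..<n}"
    using g disj by (metis (no_types, lifting) inj_onI lessThan_iff)
  moreover have "g ` {..<n} \<subseteq> (SIGMA v:J. {x. (v, x) \<in> P})"
    using g by blast
  moreover have fin: "finite (SIGMA v:J. {x. (v, x) \<in> P})"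
    using J(1) finite_out[OF P] by (intro finite_SigmaI)
  ultimately have "n \<le> card (SIGMA v:J. {x. (v, x) \<in> P})"
    using card_inj_on_le by fastforce
  also have "\<dots> = (\<Sum>v\<in>J. out_deg P v)"
    unfolding out_deg_def using J(1) finite_out[OF P] by (intro card_SigmaI) auto
  also have "\<dots> \<le> (\<Sum>v\<in>J. c)"
    using J(2) by (rule sum_mono)
  finally show False using n by simp
qed

text \<open>
  Suppose all out-degrees are at most \<open>k + 2\<close>. A \<open>Source\<close> into which no hub directs an edge has
  out-degree \<open>j\<close>, so its hubs do not. Among the leaves of a \<open>Star\<close> into which no hub directs an edge,
  one has out-degree \<open>k + 1\<close>: each leaf has out-degree \<open>k\<close> or \<open>k + 1\<close>, and if all had \<open>k\<close>, then the
  centre of the star would be a source of out-degree \<open>k\<close>, like its neighbours. Hence a hub with index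
  below \<open>k + 3\<close> has out-degree \<open>0\<close> or \<open>k + 2\<close>. Of the two centres of the tree of hubs one has an
  outgoing arc; it cannot be directed towards all of its \<open>k + 3\<close> neighbours in the tree, and one that
  is directed towards it has out-degree \<open>k + 2\<close>, too.
\<close>

lemma tight_no_proper_orientation:
  assumes k: "1 \<le> k" and P: "proper_orientation (tight_E k) P"
    and small: "\<And>v. v \<in> tight_V k \<Longrightarrow> out_deg P v \<le> k + 2"
  shows False
proof -
  interpret finite_simple_graph "tight_V k" "tight_E k"
    using tight_bipartite by unfold_locales (simp add: bipartite_graph_def)
  have o: "orientation (tight_E k) P"
    and proper: "\<And>u v. {u, v} \<in> tight_E k \<Longrightarrow> out_deg P u \<noteq> out_deg P v"
    using P by (auto simp: proper_orientation_def)
  have hub_small: "out_deg P (Hub s m) \<le> k + 2" if "m < 2 * k + 3" for s m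
    using that by (intro small) (auto simp: tight_V_def image_iff)
  have out_all: "out_deg P u = card S"
    if "\<And>w. (u, w) \<in> P \<longleftrightarrow> w \<in> S" for u S
    using that by (simp add: out_deg_def)
  have arcs_out: "(u, w) \<in> P" if "{u, w} \<in> tight_E k" "(w, u) \<notin> P" for u w
    using arc_total[OF o] that by blast

  have low: "out_deg P (Hub s h) \<noteq> j" if h: "h < k + 3" and j: "1 \<le> j" "j \<le> k" for s h j
  proof -
    let ?J = "Hub s ` {h..<h + j}"
    have cJ: "card ?J = j" by (simp add: card_image inj_on_def)
    have "j * (k + 2) \<le> k * (k + 2)" using j(2) by (rule mult_le_mono1)
    then have "card ?J * (k + 2) < copies k" unfolding cJ copies_def by linarith
    then obtain i where i: "i < copies k"
      and unhit: "\<And>v x. v \<in> ?J \<Longrightarrow> x \<in> {Source s h j i} \<Longrightarrow> (v, x) \<notin> P"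
      by (rule ex_unhit_block[OF o, of ?J "k + 2" _ "\<lambda>i. {Source s h j i}", rotated 2])
        (use hub_small h j in auto)
    have "(Source s h j i, w) \<in> P \<longleftrightarrow> w \<in> ?J" for w
    proof
      assume "(Source s h j i, w) \<in> P"
      then have "{Source s h j i, w} \<in> tight_E k" by (rule arc_edge[OF o])
      then show "w \<in> ?J" unfolding tight_edge_iff by (cases w) auto
    next
      assume w: "w \<in> ?J"
      then have "{Source s h j i, w} \<in> tight_E k"
        unfolding tight_edge_iff using i h j by auto
      then show "(Source s h j i, w) \<in> P" using unhit[OF w] by (intro arcs_out) auto
    qed
    then have "out_deg P (Source s h j i) = j" using cJ out_all by metis
    moreover have "{Source s h j i, Hub s h} \<in> tight_E k"
      unfolding tight_edge_iff using i h j by auto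
    ultimately show ?thesis using proper by metis
  qed

  have high: "out_deg P (Hub s h) \<noteq> k + 1" if h: "h < k + 3" for s h
  proof -
    let ?J = "Hub s ` {h..<h + k}"
    have cJ: "card ?J = k" by (simp add: card_image inj_on_def)
    have "card ?J * (k + 2) < copies k" unfolding cJ copies_def by linarith
    then obtain i where i: "i < copies k"
      and unhit: "\<And>v x. v \<in> ?J \<Longrightarrow> x \<in> Leaf s h i ` {..<k} \<Longrightarrow> (v, x) \<notin> P"
      by (rule ex_unhit_block[OF o, of ?J "k + 2" _ "\<lambda>i. Leaf s h i ` {..<k}", rotated 2])
        (use hub_small h in auto)
    have leaf_edge: "{Leaf s h i l, w} \<in> tight_E k \<longleftrightarrow> w = Star s h i \<or> w \<in> ?J" if "l < k" for l w
      unfolding tight_edge_iff using that i h by (cases w) auto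
    have leaf_hub: "(Leaf s h i l, w) \<in> P" if "l < k" "w \<in> ?J" for l w
      using that leaf_edge[OF that(1)] unhit by (intro arcs_out) auto
    have "\<exists>l<k. (Star s h i, Leaf s h i l) \<notin> P"
    proof (rule ccontr)
      assume "\<not> ?thesis"
      then have all: "(Star s h i, Leaf s h i l) \<in> P" if "l < k" for l using that by blast
      have "(Star s h i, w) \<in> P \<longleftrightarrow> w \<in> Leaf s h i ` {..<k}" for w
      proof
        assume "(Star s h i, w) \<in> P"
        then have "{Star s h i, w} \<in> tight_E k" by (rule arc_edge[OF o])
        then show "w \<in> Leaf s h i ` {..<k}" unfolding tight_edge_iff by (cases w) auto
      qed (use all in auto)
      then have "out_deg P (Star s h i) = card (Leaf s h i ` {..<k})" by (rule out_all)
      then have star: "out_deg P (Star s h i) = k" by (simp add: card_image inj_on_def)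
      have "(Leaf s h i 0, w) \<in> P \<longleftrightarrow> w \<in> ?J" for w
      proof
        assume w: "(Leaf s h i 0, w) \<in> P"
        then have "w \<noteq> Star s h i" using arc_asym[OF o] all k by force
        then show "w \<in> ?J" using leaf_edge[of 0 w] arc_edge[OF o w] k by auto
      qed (use leaf_hub k in auto)
      then have "out_deg P (Leaf s h i 0) = k" using cJ out_all by metis
      moreover have "{Leaf s h i 0, Star s h i} \<in> tight_E k" using leaf_edge k by auto
      ultimately show False using proper star by metis
    qed
    then obtain l where l: "l < k" "(Star s h i, Leaf s h i l) \<notin> P" by blast
    have "(Leaf s h i l, w) \<in> P \<longleftrightarrow> w \<in> insert (Star s h i) ?J" for w
    proof
      assume "(Leaf s h i l, w) \<in> P"
      then show "w \<in> insert (Star s h i) ?J"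
        using leaf_edge[OF l(1)] arc_edge[OF o] by blast
    next
      assume "w \<in> insert (Star s h i) ?J"
      then show "(Leaf s h i l, w) \<in> P"
        using leaf_hub[OF l(1)] leaf_edge[OF l(1)] l(2) arcs_out by blast
    qed
    then have "out_deg P (Leaf s h i l) = card (insert (Star s h i) ?J)" by (rule out_all)
    also have "\<dots> = k + 1" using cJ by (subst card_insert_disjoint) auto
    finally have "out_deg P (Leaf s h i l) = k + 1" .
    moreover have "{Leaf s h i l, Hub s h} \<in> tight_E k" using leaf_edge[OF l(1)] k by auto
    ultimately show ?thesis using proper by metis
  qed

  have hub: "out_deg P (Hub s h) = k + 2" if h: "h < k + 3" and arc: "(Hub s h, w) \<in> P" for s h w
  proof -
    have "out_deg P (Hub s h) \<noteq> 0"
      unfolding out_deg_def using arc finite_out[OF o, of "Hub s h"] by auto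
    then have "\<not> out_deg P (Hub s h) \<le> k"
      using low[OF h, of "out_deg P (Hub s h)" s] by auto
    then show ?thesis using high[OF h, of s] hub_small[of h s] h by linarith
  qed
  have tree: "{Hub s 0, Hub (\<not> s) m} \<in> tight_E k" if "m < k + 3" for s m
    using that unfolding tight_edge_iff by simp
  have "(Hub True 0, Hub (\<not> True) 0) \<in> P \<or> (Hub False 0, Hub (\<not> False) 0) \<in> P"
    using arc_total[OF o tree[of 0 True]] by auto
  then obtain s where s: "(Hub s 0, Hub (\<not> s) 0) \<in> P" by blast
  have centre: "out_deg P (Hub s 0) = k + 2" using hub[OF _ s] by simp
  have "\<exists>m<k + 3. (Hub s 0, Hub (\<not> s) m) \<notin> P"
  proof (rule ccontr)
    assume "\<not> ?thesis"
    then have "Hub (\<not> s) ` {..<k + 3} \<subseteq> {w. (Hub s 0, w) \<in> P}" by auto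
    then have "card (Hub (\<not> s) ` {..<k + 3}) \<le> out_deg P (Hub s 0)"
      unfolding out_deg_def using finite_out[OF o] by (rule card_mono[rotated])
    then show False using centre by (simp add: card_image inj_on_def)
  qed
  then obtain m where m: "m < k + 3" "(Hub s 0, Hub (\<not> s) m) \<notin> P" by blast
  then have "(Hub (\<not> s) m, Hub s 0) \<in> P" using arc_total[OF o tree[OF m(1)]] by blast
  then have "out_deg P (Hub (\<not> s) m) = k + 2" by (rule hub[OF m(1)])
  then show False using centre proper[OF tree[OF m(1)]] by metis
qed

lemma bipartite_graph_image:
  assumes "bipartite_graph V E" and f: "inj f"
  shows "bipartite_graph (f ` V) ((`) f ` E)"
proof -
  obtain A B where AB: "A \<union> B = V" "A \<inter> B = {}" "\<forall>e\<in>E. \<exists>a\<in>A. \<exists>b\<in>B. e = {a, b}"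
    and simple: "simple_graph V E"
    using assms(1) by (auto simp: bipartite_graph_def)
  have "simple_graph (f ` V) ((`) f ` E)"
    using simple f by (auto simp: simple_graph_def card_image inj_on_subset)
  moreover have "f ` A \<union> f ` B = f ` V" "f ` A \<inter> f ` B = {}"
    using AB(1,2) f by (auto simp: inj_eq)
  moreover have "\<forall>e\<in>(`) f ` E. \<exists>a\<in>f ` A. \<exists>b\<in>f ` B. e = {a, b}"
    using AB(3) by fastforce
  ultimately show ?thesis unfolding bipartite_graph_def by blast
qed

lemma doubleton_image_iff:
  assumes "inj f"
  shows "{f u, f v} \<in> (`) f ` E \<longleftrightarrow> {u, v} \<in> E"
proof -
  have "{f u, f v} \<in> (`) f ` E \<longleftrightarrow> f ` {u, v} \<in> (`) f ` E" by simp
  also have "\<dots> \<longleftrightarrow> {u, v} \<in> E"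
    using assms by (auto simp only: image_iff inj_image_eq_iff)
  finally show ?thesis .
qed

lemma proper_orientation_vimage:
  assumes f: "inj f" and P: "proper_orientation ((`) f ` E) P"
  defines "Q \<equiv> {(u, v). (f u, f v) \<in> P}"
  shows "proper_orientation E Q" and "out_deg Q u = out_deg P (f u)"
proof -
  have o: "orientation ((`) f ` E) P" using P by (simp add: proper_orientation_def)
  show out: "out_deg Q u = out_deg P (f u)" for u
  proof -
    have "{x. (f u, x) \<in> P} = f ` {w. (u, w) \<in> Q}"
    proof
      show "{x. (f u, x) \<in> P} \<subseteq> f ` {w. (u, w) \<in> Q}"
      proof
        fix x assume x: "x \<in> {x. (f u, x) \<in> P}"
        then have "{f u, x} \<in> (`) f ` E" using o by (simp add: orientation_def)
        then obtain w where "x = f w" by auto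
        then show "x \<in> f ` {w. (u, w) \<in> Q}" using x by (auto simp: Q_def)
      qed
    qed (auto simp: Q_def)
    then show ?thesis
      using f by (simp add: out_deg_def card_image inj_on_subset)
  qed
  show "proper_orientation E Q"
    using P unfolding proper_orientation_def orientation_def out
    by (auto simp: Q_def simp flip: doubleton_image_iff[OF f])
qed

lemma ex_tight_graph:
  assumes k: "1 \<le> k"
  shows "\<exists>(V :: nat set) E. bipartite_graph V E \<and> \<lceil>mad V E / 2\<rceil> = int k
    \<and> proper_orientation_number V E = k + 3"
proof -
  define f :: "vertex \<Rightarrow> nat" where "f = to_nat"
  have f: "inj f" by (simp add: f_def)
  let ?V = "f ` tight_V k" and ?E = "(`) f ` tight_E k"
  have bip: "bipartite_graph ?V ?E"
    using tight_bipartite f by (rule bipartite_graph_image)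
  interpret finite_simple_graph ?V ?E
    using bip by unfold_locales (simp add: bipartite_graph_def)
  let ?D = "{(f u, f v) | u v. tight_arc k u v}"
  have "mad ?V ?E / 2 \<le> real k"
  proof (rule mad_le)
    fix V' E' assume "subgraph_of V' E' ?V ?E"
    then show "card E' \<le> k * card V'"
    proof (rule subgraph_card_le[where D = ?D])
      fix x y assume "{x, y} \<in> ?E"
      then obtain u v where "{x, y} = {f u, f v}" "tight_arc k u v"
        by (auto simp: tight_E_def)
      then show "(x, y) \<in> ?D \<or> (y, x) \<in> ?D"
        unfolding doubleton_eq_iff by blast
    next
      fix x assume "x \<in> ?V"
      then obtain u where u: "x = f u" by blast
      have "{y. (x, y) \<in> ?D} = f ` {w. tight_arc k u w}"
        using f by (auto simp: u inj_eq)
      then show "finite {y. (x, y) \<in> ?D} \<and> out_deg ?D x \<le> k"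
        unfolding out_deg_def using tight_arc_out[OF k, of u] f
        by (simp add: card_image inj_on_subset)
    qed
  qed
  then have mad: "\<lceil>mad ?V ?E / 2\<rceil> \<le> int k" by (simp add: ceiling_le_iff)
  have "\<not> proper_orientation_number ?V ?E \<le> k + 2"
  proof
    assume le: "proper_orientation_number ?V ?E \<le> k + 2"
    obtain P where P: "proper_orientation ?E P"
      "\<And>v. v \<in> ?V \<Longrightarrow> out_deg P v \<le> proper_orientation_number ?V ?E"
      using proper_orientation_number_attained by blast
    note Q = proper_orientation_vimage[OF f P(1)]
    show False
      by (rule tight_no_proper_orientation[OF k Q(1)]) (use Q(2) P(2) le in \<open>auto intro: order_trans\<close>)
  qed
  then show ?thesis
    using bipartite_proper_orientation_number_le[OF bip] mad bip
    by (intro exI[of _ ?V] exI[of _ ?E]) linarith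
qed

section \<open>The bounds and their tightness\<close>

theorem theorem1p2:
  shows "(\<forall>(V :: 'a set) E. bipartite_graph V E \<longrightarrow>
            \<lceil>mad V E / 2\<rceil> \<le> int (proper_orientation_number V E) \<and>
            int (proper_orientation_number V E) \<le> \<lceil>mad V E / 2\<rceil> + 3) \<and>
         (\<forall>k :: nat. k \<ge> 1 \<longrightarrow>
            (\<exists>(V :: nat set) E. bipartite_graph V E \<and>
               \<lceil>mad V E / 2\<rceil> = int k \<and> proper_orientation_number V E = k + 3))"
proof (intro conjI allI impI)
  fix V :: "'a set" and E assume bip: "bipartite_graph V E"
  then interpret finite_simple_graph V E
    by unfold_locales (simp add: bipartite_graph_def)
  show "\<lceil>mad V E / 2\<rceil> \<le> int (proper_orientation_number V E)"
    by (rule mad_le_proper_orientation_number)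
  show "int (proper_orientation_number V E) \<le> \<lceil>mad V E / 2\<rceil> + 3"
    using bip by (rule bipartite_proper_orientation_number_le)
qed (rule ex_tight_graph)

end
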